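(* Let $T$ be an ergodic measure-preserving map on the probability space $(X,\mathcal{A},\mu)$, $\theta\in(0,1]$, and $(A_l)_{l\ge 1}$ a sequence in $\mathcal{A}$ such that $0<\mu(A_l)\to 0$ and $A_l=A_l^{\bullet}\cup A_l^{\circ}$ (measurable and disjoint). Suppose that the normalized hitting times converge to an exponential law, $$\mu\big(\mu(A_l)\,\varphi_{A_l}\le t\big)\Longrightarrow 1-e^{-\theta t}\qquad\text{as } l\to\infty.$$ For $l\ge 1$ let $\mathcal{V}_l$ be a family of probability measures on $(A_l,\mathcal{A}\cap A_l)$, and assume that $$\sup_{\nu_l\in\mathcal{V}_l}\big|\nu_l(A_l^{\circ})-\theta\big|\to 0\qquad\text{and}\qquad \mu(A_l)\,\sup_{\nu_l\in\mathcal{V}_l}\|1_{A_l^{\bullet}}\varphi_{A_l}\|_{L_\infty(\nu_l^{\bullet})}\to 0\qquad\text{as } l\to\infty.$$ (a) If for every sequence $(k_l)\in\mathcal{K}(A_l)$, $$\big|\nu_l^{\circ}(\varphi_{A_l}=k_l)-\mu(\varphi_{A_l}=k_l)\big|=o(\mu(A_l))\qquad\text{as } l\to\infty,\ \text{uniformly in } (\nu_l)\in\textstyle\prod_{l\ge 1}\mathcal{V}_l, \qquad( * )$$ then, for every $\delta\in(0,1]$, $$\nu_l(\varphi_{A_l}=k_l)\sim\theta^2 e^{-\theta\mu(A_l)k_l}\,\mu(A_l)\qquad\text{as } l\to\infty,\ \text{uniformly in } (\nu_l)\in\textstyle\prod_{l\ge 1}\mathcal{V}_l\text{ and } (k_l)\in\mathcal{K}_\delta(A_l).$$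 (b) Condition $( * )$ (for every $(k_l)\in\mathcal{K}(A_l)$) is satisfied whenever there are measurable $\tau_l:A_l^{\circ}\to\{0,1,2,\ldots,\infty\}$, $l\ge 1$, such that, for every $\varepsilon>0$, $$\nu_l^{\circ}\big(\mu(A_l)\tau_l>\varepsilon\big)=o(\mu(A_l))\qquad\text{as } l\to\infty,\ \text{uniformly in } (\nu_l)\in\textstyle\prod_{l\ge 1}\mathcal{V}_l,$$ and some family $\mathcal{V}$ of probability measures on $(X,\mathcal{A})$ which is LLT-uniform for $(A_l)$ and such that $$\nu^{\circ}_{l,\{\tau_l=j\}}\circ T^{-j}\in\mathcal{V}\qquad\text{for } l\ge 1,\ \nu_l\in\mathcal{V}_l,\text{ and those integers } j\ge 0\text{ for which } \nu_l^{\circ}(\tau_l=j)>0,$$ while for all sequences $(k_l)\in\mathcal{K}(A_l)$, $$\nu_l^{\circ}\big(\{\varphi_{A_l}\le\tau_l\}\cap T^{-k_l}A_l\big)=o(\mu(A_l))\qquad\text{as } l\to\infty,\ \text{uniformly in } (\nu_l)\in\textstyle\prod_{l\ge 1}\mathcal{V}_l.$$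
   Context: For $A\in\mathcal{A}$ the hitting time function is $\varphi_A(x):=\inf\{n\ge 1: T^n x\in A\}\in\{1,2,\ldots,\infty\}$, $x\in X$; it is finite $\mu$-a.e. if $\mu(A)>0$. $F_l(t)\Rightarrow F(t)$ means $F_l(t)\to F(t)$ at every continuity point $t$ of $F$. For $\delta\in(0,1]$, $\mathcal{K}_\delta(A_l):=\{(k_l)_{l\ge 1}: k_l\in\mathbb{N},\ \delta\le \mu(A_l)k_l\le\delta^{-1}\text{ for } l\ge 1\}$, and $\mathcal{K}(A_l):=\bigcup_{\delta\in(0,1]}\mathcal{K}_\delta(A_l)$. For a measure $\nu$ and a measurable set $B$ with $\nu(B)>0$, $\nu_B$ (or $\nu_{l,B}$ if $\nu=\nu_l$) denotes $\nu$ conditioned on $B$, $\nu_B(E)=\nu(B\cap E)/\nu(B)$. For $\nu_l\in\mathcal{V}_l$, $\nu_l^{\bullet}:=\nu_{l,A_l^{\bullet}}$ if $\nu_l(A_l^{\bullet})>0$ and $\nu_l^{\bullet}:=0$ otherwise; $\nu_l^{\circ}:=\nu_{l,A_l^{\circ}}$ if $\nu_l(A_l^{\circ})>0$ and $\nu_l^{\circ}:=0$ otherwise. Measures on $A_l$ are also regarded as measures on $X$. An element $(\nu_l)$ of $\prod_{l\ge 1}\mathcal{V}_l$ is a sequence with $\nu_l\in\mathcal{V}_l$ for all $l$. Uniformity of $a_l=o(b_l)$ (resp. $a_l\sim b_l$) in some parameters means that for every $\varepsilon>0$ there is $l_0$ such that $|a_l|\le\varepsilon b_l$ (resp. $|a_l/b_l-1|\le\varepsilon$)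 for all $l\ge l_0$ and all admissible parameters. A family $\mathcal{V}$ of probability measures on $(X,\mathcal{A})$ is called LLT-uniform for $(A_l)$ if for every $(k_l)\in\mathcal{K}(A_l)$, $|\nu(\varphi_{A_l}=k_l)-\mu(\varphi_{A_l}=k_l)|=o(\mu(A_l))$ as $l\to\infty$, uniformly in $\nu\in\mathcal{V}$. *)

theory Defs
  imports "HOL-Probability.Probability"
begin

text \<open>Sequences indexed by \<open>l \<ge> 1\<close> in the source are functions on \<^typ>\<open>nat\<close> here, i.e. the index
  is shifted by one.\<close>

definition ergodic_measure_preserving :: "'a measure \<Rightarrow> ('a \<Rightarrow> 'a) \<Rightarrow> bool" where
  "ergodic_measure_preserving M T \<longleftrightarrow>
     T \<in> measurable M M \<and> distr M M T = M \<and>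
     (\<forall>E\<in>sets M. T -` E \<inter> space M = E \<longrightarrow> emeasure M E = 0 \<or> emeasure M (space M - E) = 0)"

text \<open>The infimum of the empty set is \<open>\<infinity>\<close> in \<^typ>\<open>enat\<close>.\<close>

definition hitting_time :: "('a \<Rightarrow> 'a) \<Rightarrow> 'a set \<Rightarrow> 'a \<Rightarrow> enat" where
  "hitting_time T A x = (INF n\<in>{n. 1 \<le> n \<and> (T ^^ n) x \<in> A}. enat n)"

text \<open>The measure \<open>\<nu>\<^sub>B\<close> conditioned on \<open>B\<close>, with the convention that it is the zero measure if
  \<open>\<nu>(B) = 0\<close>.\<close>

definition cond_measure :: "'a measure \<Rightarrow> 'a set \<Rightarrow> 'a measure" where
  "cond_measure \<nu> B = (if measure \<nu> B > 0 then uniform_measure \<nu> B else null_measure \<nu>)"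

definition scale_seqs_delta :: "'a measure \<Rightarrow> (nat \<Rightarrow> 'a set) \<Rightarrow> real \<Rightarrow> (nat \<Rightarrow> nat) set" where
  "scale_seqs_delta M A \<delta> =
     {k. \<forall>l. \<delta> \<le> measure M (A l) * real (k l) \<and> measure M (A l) * real (k l) \<le> 1 / \<delta>}"

definition scale_seqs :: "'a measure \<Rightarrow> (nat \<Rightarrow> 'a set) \<Rightarrow> (nat \<Rightarrow> nat) set" where
  "scale_seqs M A = (\<Union>\<delta>\<in>{0<..1}. scale_seqs_delta M A \<delta>)"

definition uniformly_smallo :: "'p set \<Rightarrow> ('p \<Rightarrow> nat \<Rightarrow> real) \<Rightarrow> (nat \<Rightarrow> real) \<Rightarrow> bool" where
  "uniformly_smallo P a b \<longleftrightarrow> (\<forall>\<epsilon>>0. \<exists>l0. \<forall>l\<ge>l0. \<forall>p\<in>P. \<bar>a p l\<bar> \<le> \<epsilon> * b l)"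

definition uniformly_asymp_equiv ::
    "'p set \<Rightarrow> ('p \<Rightarrow> nat \<Rightarrow> real) \<Rightarrow> ('p \<Rightarrow> nat \<Rightarrow> real) \<Rightarrow> bool" where
  "uniformly_asymp_equiv P a b \<longleftrightarrow>
     (\<forall>\<epsilon>>0. \<exists>l0. \<forall>l\<ge>l0. \<forall>p\<in>P. \<bar>a p l / b p l - 1\<bar> \<le> \<epsilon>)"

definition prob_measures_on :: "'a measure \<Rightarrow> 'a measure set" where
  "prob_measures_on M = {\<nu>. prob_space \<nu> \<and> space \<nu> = space M \<and> sets \<nu> = sets M}"

definition LLT_uniform ::
    "'a measure \<Rightarrow> ('a \<Rightarrow> 'a) \<Rightarrow> (nat \<Rightarrow> 'a set) \<Rightarrow> 'a measure set \<Rightarrow> bool" where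
  "LLT_uniform M T A \<V> \<longleftrightarrow>
     (\<forall>k\<in>scale_seqs M A.
        uniformly_smallo \<V>
          (\<lambda>\<nu> l. \<bar>\<P>(x in \<nu>. hitting_time T (A l) x = enat (k l))
                 - \<P>(x in M. hitting_time T (A l) x = enat (k l))\<bar>)
          (\<lambda>l. measure M (A l)))"

text \<open>The local limit condition for the conditioned measures \<open>\<nu>\<^sub>l\<^sup>\<circ>\<close>, where \<open>Ac l\<close> is \<open>A\<^sub>l\<^sup>\<circ>\<close>.
  Elements of \<open>V l\<close> live on \<open>A l\<close>, so \<open>\<nu>(\<phi> = k)\<close> means \<open>\<nu>(A l \<inter> {\<phi> = k})\<close>.\<close>

definition LLT_circ ::
    "'a measure \<Rightarrow> ('a \<Rightarrow> 'a) \<Rightarrow> (nat \<Rightarrow> 'a set) \<Rightarrow> (nat \<Rightarrow> 'a set)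
      \<Rightarrow> (nat \<Rightarrow> 'a measure set) \<Rightarrow> bool" where
  "LLT_circ M T A Ac V \<longleftrightarrow>
     (\<forall>k\<in>scale_seqs M A.
        uniformly_smallo (Pi UNIV V)
          (\<lambda>\<nu> l. \<bar>\<P>(x in cond_measure (\<nu> l) (Ac l). hitting_time T (A l) x = enat (k l))
                 - \<P>(x in M. hitting_time T (A l) x = enat (k l))\<bar>)
          (\<lambda>l. measure M (A l)))"

end

theory Submission
  imports Defs
begin

text \<open>Under \<open>\<mu>\<close> the density \<open>k \<mapsto> \<mu>(\<phi> = k)\<close> is nonincreasing, so the exponential limit law for the
  distribution function upgrades to a local limit law
  \<open>\<mu>(\<phi> = k) = \<theta> exp (- \<theta> \<mu>(A) k) \<mu>(A) + o(\<mu>(A))\<close>, uniformly at scale \<open>k \<approx> 1/\<mu>(A)\<close>.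
  Under \<open>\<nu>\<^sub>l\<close> the part \<open>A\<^sub>l\<^sup>\<bullet>\<close> returns too early to contribute at that scale, and \<open>A\<^sub>l\<^sup>\<circ>\<close>, of mass about
  \<open>\<theta>\<close>, contributes like \<open>\<mu>\<close>; this yields the factor \<open>\<theta>\<^sup>2\<close>. For the sufficient criterion, split
  \<open>A\<^sub>l\<^sup>\<circ>\<close> according to \<open>\<tau>\<^sub>l = j\<close>: up to points returning before \<open>\<tau>\<^sub>l\<close>, the event \<open>\<phi> = k\<close> is
  \<open>\<phi> \<circ> T\<^sup>j = k - j\<close>, whose probability is governed by \<open>\<V>\<close>, and shifting \<open>k\<close> by \<open>j = o(1/\<mu>(A))\<close>
  does not change the local limit.\<close>

section \<open>Hitting times along an orbit: attainment, measurability and shifts\<close>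

text \<open>\<open>enat\<close> is well ordered, so the infimum over a nonempty set of times is
  attained; an empty set would give \<infinity>. This replaces the infimum by a first-order
  description of the orbit.\<close>

lemma enat_eq_hitting_time_iff:
  "hitting_time T A x = enat k \<longleftrightarrow>
     1 \<le> k \<and> (T ^^ k) x \<in> A \<and> (\<forall>i. 1 \<le> i \<and> i < k \<longrightarrow> (T ^^ i) x \<notin> A)"
proof
  assume eq: "hitting_time T A x = enat k"
  let ?S = "{n. 1 \<le> n \<and> (T ^^ n) x \<in> A}"
  have "?S \<noteq> {}"
  proof
    assume "?S = {}"
    then show False
      using eq unfolding hitting_time_def by (simp only:) (simp add: top_enat_def)
  qed
  then obtain n where "enat n \<in> enat ` ?S"
    by blast
  then have "hitting_time T A x \<in> enat ` ?S"
    unfolding hitting_time_def by (rule wellorder_InfI)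
  moreover have "k \<le> i" if "i \<in> ?S" for i
    using INF_lower[OF that, of enat] eq by (simp add: hitting_time_def)
  ultimately show "1 \<le> k \<and> (T ^^ k) x \<in> A \<and> (\<forall>i. 1 \<le> i \<and> i < k \<longrightarrow> (T ^^ i) x \<notin> A)"
    using eq by (auto simp: not_le[symmetric])
next
  assume "1 \<le> k \<and> (T ^^ k) x \<in> A \<and> (\<forall>i. 1 \<le> i \<and> i < k \<longrightarrow> (T ^^ i) x \<notin> A)"
  then show "hitting_time T A x = enat k"
    unfolding hitting_time_def
    by (intro antisym INF_lower2[of k] INF_greatest) (auto simp: not_less[symmetric])
qed

lemma hitting_time_le_iff:
  "hitting_time T A x \<le> enat n \<longleftrightarrow> (\<exists>i. 1 \<le> i \<and> i \<le> n \<and> (T ^^ i) x \<in> A)"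
proof
  assume "hitting_time T A x \<le> enat n"
  moreover from this obtain k where "hitting_time T A x = enat k"
    by (cases "hitting_time T A x") auto
  ultimately show "\<exists>i. 1 \<le> i \<and> i \<le> n \<and> (T ^^ i) x \<in> A"
    by (metis enat_eq_hitting_time_iff enat_ord_simps(1))
next
  assume "\<exists>i. 1 \<le> i \<and> i \<le> n \<and> (T ^^ i) x \<in> A"
  then obtain i where "1 \<le> i" "i \<le> n" "(T ^^ i) x \<in> A"
    by blast
  then show "hitting_time T A x \<le> enat n"
    unfolding hitting_time_def by (intro INF_lower2[of i]) auto
qed

lemma measurable_hitting_time:
  assumes T: "T \<in> measurable M M" and A: "A \<in> sets M"
  shows "hitting_time T A \<in> measurable M (count_space UNIV)"
proof (rule measurable_count_space_eq2_countable[THEN iffD2])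
  have [measurable]: "T ^^ i \<in> measurable M M" for i
    using T by (rule measurable_compose_n)
  note A[measurable]
  have fin: "hitting_time T A -` {enat k} \<inter> space M \<in> sets M" for k
  proof -
    have "hitting_time T A -` {enat k} \<inter> space M =
        {x \<in> space M. 1 \<le> k \<and> (T ^^ k) x \<in> A \<and> (\<forall>i. 1 \<le> i \<and> i < k \<longrightarrow> (T ^^ i) x \<notin> A)}"
      by (auto simp: enat_eq_hitting_time_iff)
    also have "\<dots> \<in> sets M"
      by measurable
    finally show ?thesis .
  qed
  have "hitting_time T A -` {a} \<inter> space M \<in> sets M" for a
  proof (cases a)
    case (enat k)
    then show ?thesis using fin by simp
  next
    case infinity
    then have "hitting_time T A -` {a} \<inter> space M =
        space M - (\<Union>k. hitting_time T A -` {enat k} \<inter> space M)"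
      by auto
    also have "\<dots> \<in> sets M"
      using fin by (intro sets.Diff sets.top sets.countable_UN) auto
    finally show ?thesis .
  qed
  then show "hitting_time T A \<in> space M \<rightarrow> UNIV \<and>
      (\<forall>a\<in>UNIV. hitting_time T A -` {a} \<inter> space M \<in> sets M)"
    by simp
qed

text \<open>The first \<open>j\<close> iterates miss \<open>A\<close>, so the count restarts at
  \<open>(T ^^ j) x\<close> with \<open>j\<close> steps already spent.\<close>

lemma hitting_time_shift:
  assumes "hitting_time T A x = enat k" and "j < k"
  shows "hitting_time T A ((T ^^ j) x) = enat (k - j)"
  using assms
  by (auto simp: enat_eq_hitting_time_iff funpow_add[symmetric, THEN fun_cong, unfolded comp_def])

text \<open>The orbit of \<open>(T ^^ j) x\<close> says nothing about times up to \<open>j\<close>,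
  so the converse of the shift can fail only through an entrance into \<open>A\<close> by time
  \<open>j\<close>. The visit at time \<open>k\<close> is recorded in both cases, because
  exceptional points are later estimated by an early return together with this visit.\<close>

lemma hitting_time_unshift:
  assumes "hitting_time T A ((T ^^ j) x) = enat (k - j)" and "j < k"
  shows "(T ^^ k) x \<in> A \<and> (hitting_time T A x = enat k \<or> hitting_time T A x \<le> enat j)"
proof -
  have *: "(T ^^ i) x = (T ^^ (i - j)) ((T ^^ j) x)" if "j \<le> i" for i
    using that by (simp add: funpow_add[symmetric, THEN fun_cong, unfolded comp_def])
  have "(T ^^ k) x \<in> A"
    using assms *[of k] by (simp add: enat_eq_hitting_time_iff)
  moreover have "(T ^^ i) x \<notin> A" if "j < i" "i < k" for i
    using assms *[of i] that unfolding enat_eq_hitting_time_iff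
    by (metis One_nat_def Suc_leI diff_less_mono less_imp_le zero_less_diff)
  ultimately show ?thesis
    using assms(2) unfolding enat_eq_hitting_time_iff hitting_time_le_iff
    by (metis Suc_leI le0 le_less_trans not_le One_nat_def)
qed

section \<open>The local limit law under the invariant measure\<close>

text \<open>Polya's argument: convergence on a finite grid is uniform, monotonicity traps
  \<open>F l t\<close> between the values at the two neighbouring grid points, and uniform
  continuity of \<open>G\<close> makes its variation over one cell small.\<close>

lemma mono_pointwise_imp_uniform_Icc:
  fixes F :: "nat \<Rightarrow> real \<Rightarrow> real" and G :: "real \<Rightarrow> real"
  assumes mono: "\<And>l. mono_on {a..b} (F l)"
    and lim: "\<And>t. t \<in> {a..b} \<Longrightarrow> (\<lambda>l. F l t) \<longlonglongrightarrow> G t"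
    and cont: "continuous_on {a..b} G"
  shows "uniform_limit {a..b} F G sequentially"
proof (rule uniform_limitI)
  fix e :: real assume "0 < e"
  have "uniformly_continuous_on {a..b} G"
    using cont by (intro compact_uniformly_continuous) auto
  then obtain d where d: "0 < d"
    "\<And>s t. s \<in> {a..b} \<Longrightarrow> t \<in> {a..b} \<Longrightarrow> dist t s < d \<Longrightarrow> dist (G t) (G s) < e / 2"
    unfolding uniformly_continuous_on_def using \<open>0 < e\<close> by (metis half_gt_zero)
  \<comment> \<open>The mesh is half of the continuity modulus \<open>d\<close>, so both ends of a
    cell are closer than \<open>d\<close> to each of its points. Clipping at \<open>b\<close> keeps
    the last grid point in the interval.\<close>
  define g where "g i = min b (a + real i * (d / 2))" for i
  obtain N :: nat where N: "(b - a) / (d / 2) < real N"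
    using reals_Archimedean2 by blast
  have "eventually (\<lambda>l. \<forall>i\<in>{..N}. g i \<in> {a..b} \<longrightarrow> dist (F l (g i)) (G (g i)) < e / 2) sequentially"
    using tendstoD[OF lim half_gt_zero[OF \<open>0 < e\<close>]]
    by (intro eventually_ball_finite) (auto intro: eventually_mono)
  then show "eventually (\<lambda>l. \<forall>t\<in>{a..b}. dist (F l t) (G t) < e) sequentially"
  proof eventually_elim
    case (elim l)
    show ?case
    proof
      fix t assume t: "t \<in> {a..b}"
      \<comment> \<open>The index of the cell containing \<open>t\<close>; since
        \<open>i < N\<close>, both ends \<open>g i\<close> and \<open>g (Suc i)\<close> belong to
        the controlled grid.\<close>
      define i where "i = nat \<lfloor>(t - a) / (d / 2)\<rfloor>"
      have nonneg: "0 \<le> (t - a) / (d / 2)"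
        using t d(1) by simp
      have le: "real i \<le> (t - a) / (d / 2)" and less: "(t - a) / (d / 2) < real i + 1"
        unfolding i_def using nonneg by (simp_all add: of_nat_nat)
      have "(t - a) / (d / 2) \<le> (b - a) / (d / 2)"
        using t d(1) by (intro divide_right_mono) auto
      then have "i < N"
        using le N by linarith
      have le': "a + real i * (d / 2) \<le> t" and less': "t < a + real (Suc i) * (d / 2)"
        using le less d(1) by (simp_all add: field_simps)
      have gi: "g i = a + real i * (d / 2)" "g i \<le> t" "t \<le> g (Suc i)" "g (Suc i) \<le> g i + d / 2"
        using le' less' t d(1) by (auto simp: g_def field_simps min_def)
      have in_ab: "g i \<in> {a..b}" "g (Suc i) \<in> {a..b}"
        using gi t d(1) by (auto simp: g_def)
      have "dist (F l (g i)) (G (g i)) < e / 2" "dist (F l (g (Suc i))) (G (g (Suc i))) < e / 2"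
        using elim in_ab \<open>i < N\<close> by auto
      moreover have "dist (g i) t < d" "dist (g (Suc i)) t < d"
        using gi(2-4) d(1) unfolding dist_real_def by linarith+
      then have "dist (G (g i)) (G t) < e / 2" "dist (G (g (Suc i))) (G t) < e / 2"
        using d(2) t in_ab by blast+
      moreover have "F l (g i) \<le> F l t" "F l t \<le> F l (g (Suc i))"
        using gi t in_ab by (auto intro!: mono_onD[OF mono])
      ultimately show "dist (F l t) (G t) < e"
        unfolding dist_real_def by linarith
    qed
  qed
qed

text \<open>Mean value bounds for a decreasing exponential, with slope taken at either end of the
  step, and a Lipschitz bound. They follow from 1 + x \<le> exp x at x = \<open>c * h\<close> and x
  = \<open>- (c * h)\<close>.\<close>

lemma exp_decrement_bounds:
  fixes c h s :: real
  assumes "0 \<le> c" "0 \<le> h" "0 \<le> s"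
  shows "c * h * exp (- c * (s + h)) \<le> exp (- c * s) - exp (- c * (s + h))"
    and "exp (- c * s) - exp (- c * (s + h)) \<le> c * h * exp (- c * s)"
    and "exp (- c * s) - exp (- c * (s + h)) \<le> c * h"
proof -
  have split: "exp (- c * (s + h)) = exp (- c * s) * exp (- (c * h))"
    and split': "exp (- c * s) = exp (- c * (s + h)) * exp (c * h)"
    by (simp_all add: exp_add[symmetric] algebra_simps)
  have "exp (- c * (s + h)) * (c * h) \<le> exp (- c * (s + h)) * (exp (c * h) - 1)"
    using exp_ge_add_one_self[of "c * h"] by (intro mult_left_mono) (simp_all add: algebra_simps)
  then show "c * h * exp (- c * (s + h)) \<le> exp (- c * s) - exp (- c * (s + h))"
    using split' by (simp add: algebra_simps)
  have "exp (- c * s) * (1 - exp (- (c * h))) \<le> exp (- c * s) * (c * h)"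
    using exp_ge_add_one_self[of "- (c * h)"] by (intro mult_left_mono) auto
  then show le: "exp (- c * s) - exp (- c * (s + h)) \<le> c * h * exp (- c * s)"
    using split by (simp add: algebra_simps)
  have "c * h * exp (- c * s) \<le> c * h * 1"
    using assms by (intro mult_left_mono) auto
  with le show "exp (- c * s) - exp (- c * (s + h)) \<le> c * h"
    by simp
qed

text \<open>By monotonicity, \<open>p l k / m l\<close> lies between the forward and backward difference quotients, with
  a fixed step \<open>h\<close>, of the distribution functions, and these converge uniformly.\<close>

lemma exponential_local_limit:
  fixes m :: "nat \<Rightarrow> real" and p :: "nat \<Rightarrow> nat \<Rightarrow> real" and \<theta> :: real
  assumes \<theta>: "0 < \<theta>" "\<theta> \<le> 1"
    and m: "\<And>l. 0 < m l"
    and p_nonneg: "\<And>l n. 0 \<le> p l n"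
    and p_dec: "\<And>l i j. 1 \<le> i \<Longrightarrow> i \<le> j \<Longrightarrow> p l j \<le> p l i"
    and lim: "\<And>t. 0 \<le> t \<Longrightarrow> (\<lambda>l. \<Sum>i\<in>{1..nat \<lfloor>t / m l\<rfloor>}. p l i) \<longlonglongrightarrow> 1 - exp (- \<theta> * t)"
    and \<delta>: "0 < \<delta>" and \<epsilon>: "0 < \<epsilon>"
  shows "\<forall>\<^sub>F l in sequentially. \<forall>k. \<delta> \<le> m l * real k \<and> m l * real k \<le> 1 / \<delta> \<longrightarrow>
           \<bar>p l k - \<theta> * exp (- \<theta> * (m l * real k)) * m l\<bar> \<le> \<epsilon> * m l"
proof -
  define S where "S l n = (\<Sum>i\<in>{1..n}. p l i)" for l n
  define F where "F l t = S l (nat \<lfloor>t / m l\<rfloor>)" for l t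
  define G where "G t = 1 - exp (- \<theta> * t)" for t
  \<comment> \<open>Half of \<epsilon> pays for moving the argument of the limit density by one step
    \<open>h\<close>. The other half is \<open>\<eta> * 2 / h\<close>, the error of two distribution
    function values divided by the step. The bound \<open>h \<le> \<delta>\<close> keeps
    \<open>t - h\<close> nonnegative, and \<open>R\<close> is the largest argument reached by
    \<open>t + h\<close>.\<close>
  define h where "h = min (\<epsilon> / 2) \<delta>"
  define \<eta> where "\<eta> = \<epsilon> * h / 4"
  define R where "R = 1 / \<delta> + h"
  have h: "0 < h" "h \<le> \<epsilon> / 2" "h \<le> \<delta>" and "0 < \<eta>"
    using \<delta> \<epsilon> by (auto simp: h_def \<eta>_def)
  have S_mono: "S l i \<le> S l j" if "i \<le> j" for l i j
    unfolding S_def using that p_nonneg by (intro sum_mono2) auto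
  have "mono_on {0..R} (F l)" for l
    unfolding F_def using m[of l]
    by (intro mono_onI S_mono nat_mono floor_mono divide_right_mono) auto
  moreover have "(\<lambda>l. F l t) \<longlonglongrightarrow> G t" if "t \<in> {0..R}" for t
    using lim[of t] that by (simp add: F_def S_def G_def)
  moreover have "continuous_on {0..R} G"
    unfolding G_def by (intro continuous_intros)
  ultimately have "uniform_limit {0..R} F G sequentially"
    by (rule mono_pointwise_imp_uniform_Icc)
  then have "\<forall>\<^sub>F l in sequentially. \<forall>t\<in>{0..R}. dist (F l t) (G t) < \<eta>"
    using \<open>0 < \<eta>\<close> by (rule uniform_limitD)
  then show ?thesis
  proof (eventually_elim, intro allI impI, elim conjE)
    fix l k
    assume unif: "\<forall>t\<in>{0..R}. dist (F l t) (G t) < \<eta>"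
    define t where "t = m l * real k"
    assume "\<delta> \<le> m l * real k" "m l * real k \<le> 1 / \<delta>"
    then have t: "\<delta> \<le> t" "t \<le> 1 / \<delta>"
      by (simp_all add: t_def)
    \<comment> \<open>The masses are nonincreasing only from index 1 on.\<close>
    then have "0 < k"
      using \<delta> by (cases k) (auto simp: t_def)
    have k_eq: "t / m l = real k"
      using m[of l] by (simp add: t_def)
    have F_t: "F l t = S l k"
      by (simp add: F_def k_eq)
    have near: "\<bar>F l s - G s\<bar> < \<eta>" if "0 \<le> s" "s \<le> R" for s
      using unif that by (auto simp: dist_real_def)
    have slope: "\<eta> * 2 / h = \<epsilon> / 2"
      using h by (simp add: \<eta>_def)

    \<comment> \<open>Forward difference: the \<open>j\<close> masses after \<open>k\<close> are at
      most \<open>p l k\<close>, and rounding \<open>h / m l\<close> down weakens the sum in the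
      direction needed for a lower bound on \<open>p l k\<close>.\<close>
    define j where "j = nat \<lfloor>h / m l\<rfloor>"
    have j: "real j \<le> h / m l"
      unfolding j_def using h m[of l] by (simp add: of_nat_nat)
    have "(t + h) / m l = real k + h / m l"
      using k_eq by (simp add: add_divide_distrib)
    then have "F l (t + h) = S l (k + j)"
      using h m[of l] by (simp add: F_def j_def nat_add_distrib add.commute)
    also have "\<dots> = S l k + (\<Sum>i\<in>{k+1..k+j}. p l i)"
      unfolding S_def by (rule sum.ub_add_nat) simp
    also have "\<dots> \<le> S l k + real j * p l k"
      using sum_bounded_above[of "{k+1..k+j}" "p l" "p l k"] p_dec[of k _ l] \<open>0 < k\<close> by simp
    also have "\<dots> \<le> S l k + h / m l * p l k"
      using mult_right_mono[OF j p_nonneg[of l k]] by simp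
    finally have "F l (t + h) - F l t \<le> h / m l * p l k"
      by (simp add: F_t)
    moreover have "\<bar>F l (t + h) - G (t + h)\<bar> < \<eta>" "\<bar>F l t - G t\<bar> < \<eta>"
      using t \<delta> h by (auto intro!: near simp: R_def)
    moreover have "\<theta> * h * exp (- \<theta> * (t + h)) \<le> G (t + h) - G t"
      using exp_decrement_bounds(1)[of \<theta> h t] \<theta> h t \<delta> by (simp add: G_def)
    ultimately have "h * (\<theta> * exp (- \<theta> * (t + h)) - \<eta> * 2 / h) \<le> h * (p l k / m l)"
      using h by (simp add: algebra_simps)
    then have lower: "\<theta> * exp (- \<theta> * (t + h)) - \<epsilon> / 2 \<le> p l k / m l"
      using h slope by (metis mult_le_cancel_left_pos)
    \<comment> \<open>Replacing \<open>t + h\<close> by \<open>t\<close> in the density costs at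
      most \<open>h\<close>, since the exponential has Lipschitz constant \<theta> \<le> 1.\<close>
    have "\<theta> * (exp (- \<theta> * t) - exp (- \<theta> * (t + h))) \<le> 1 * h"
      using exp_decrement_bounds(3)[of \<theta> h t] exp_decrement_bounds(1)[of \<theta> h t] \<theta> h t \<delta>
      by (intro mult_mono) (auto intro: order_trans[OF _ mult_right_mono[of \<theta> 1 h, simplified]])
    with lower h have lower': "\<theta> * exp (- \<theta> * t) - \<epsilon> \<le> p l k / m l"
      by (simp add: algebra_simps)

    \<comment> \<open>Backward difference: taking the floor of \<open>k - h / m l\<close> removes
      the ceiling of \<open>h / m l\<close> from \<open>k\<close>. The window therefore has at least
      \<open>h / m l\<close> masses, each at least \<open>p l k\<close>, which bounds
      \<open>p l k\<close> from above.\<close>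
    define i where "i = nat \<lceil>h / m l\<rceil>"
    have i: "h / m l \<le> real i"
      unfolding i_def using h m[of l] by (simp add: of_nat_nat)
    have "h / m l \<le> real k"
      unfolding k_eq[symmetric] using h t m[of l] by (intro divide_right_mono) auto
    then have "i \<le> k"
      by (simp add: i_def ceiling_le_iff nat_le_iff)
    have "(t - h) / m l = real k - h / m l"
      using k_eq by (simp add: diff_divide_distrib)
    then have "\<lfloor>(t - h) / m l\<rfloor> = int k - \<lceil>h / m l\<rceil>"
      by (simp add: ceiling_def) linarith
    moreover have "0 \<le> h / m l"
      using h m[of l] by simp
    ultimately have "nat \<lfloor>(t - h) / m l\<rfloor> = k - i"
      unfolding i_def by linarith
    then have "F l (t - h) = S l (k - i)"
      by (simp add: F_def)
    moreover have "S l k = S l (k - i) + (\<Sum>n\<in>{k-i+1..k-i+i}. p l n)"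
      using sum.ub_add_nat[of 1 "k - i" "p l" i] \<open>i \<le> k\<close> by (simp add: S_def)
    moreover have "real i * p l k \<le> (\<Sum>n\<in>{k-i+1..k-i+i}. p l n)"
      using sum_bounded_below[of "{k-i+1..k-i+i}" "p l k" "p l"] p_dec[of _ k l] \<open>i \<le> k\<close> by simp
    moreover have "h / m l * p l k \<le> real i * p l k"
      using mult_right_mono[OF i p_nonneg[of l k]] by simp
    ultimately have "h / m l * p l k \<le> F l t - F l (t - h)"
      by (simp add: F_t)
    moreover have "\<bar>F l (t - h) - G (t - h)\<bar> < \<eta>" "\<bar>F l t - G t\<bar> < \<eta>"
      using t \<delta> h by (auto intro!: near simp: R_def)
    moreover have "G t - G (t - h) \<le> \<theta> * h * exp (- \<theta> * (t - h))"
      using exp_decrement_bounds(2)[of \<theta> h "t - h"] \<theta> h t \<delta> by (simp add: G_def)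
    ultimately have "h * (p l k / m l) \<le> h * (\<theta> * exp (- \<theta> * (t - h)) + \<eta> * 2 / h)"
      using h by (simp add: algebra_simps)
    then have upper: "p l k / m l \<le> \<theta> * exp (- \<theta> * (t - h)) + \<epsilon> / 2"
      using h slope by (metis mult_le_cancel_left_pos)
    have "\<theta> * (exp (- \<theta> * (t - h)) - exp (- \<theta> * t)) \<le> 1 * h"
      using exp_decrement_bounds(3)[of \<theta> h "t - h"] exp_decrement_bounds(1)[of \<theta> h "t - h"] \<theta> h t \<delta>
      by (intro mult_mono) (auto intro: order_trans[OF _ mult_right_mono[of \<theta> 1 h, simplified]])
    with upper h have upper': "p l k / m l \<le> \<theta> * exp (- \<theta> * t) + \<epsilon>"
      by (simp add: algebra_simps)

    show "\<bar>p l k - \<theta> * exp (- \<theta> * (m l * real k)) * m l\<bar> \<le> \<epsilon> * m l"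
      using lower' upper' m[of l] unfolding t_def[symmetric]
      by (simp add: field_simps abs_le_iff)
  qed
qed

lemma sets_Collect_le_enat:
  fixes f g :: "'a \<Rightarrow> enat"
  assumes [measurable]: "f \<in> measurable M (count_space UNIV)" "g \<in> measurable M (count_space UNIV)"
  shows "{x \<in> space M. f x \<le> g x} \<in> sets M"
proof -
  have "{x \<in> space M. f x \<le> g x} = (\<Union>a. {x \<in> space M. f x = a} \<inter> {x \<in> space M. g x \<in> {a..}})"
    by auto
  also have "\<dots> \<in> sets M"
    by (intro sets.countable_UN'[of UNIV] sets.Int) (auto intro!: measurable_sets_Collect[where N="count_space UNIV"])
  finally show ?thesis .
qed

text \<open>Invariance under \<open>T\<close> makes the point masses nonincreasing from 1 on, and
  their partial sums are the distribution function of the normalized hitting time, so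
  \<open>exponential_local_limit\<close> applies.\<close>

lemma hitting_time_local_limit:
  fixes M :: "'a measure" and A :: "nat \<Rightarrow> 'a set"
  assumes "prob_space M"
    and T: "T \<in> measurable M M" "distr M M T = M"
    and \<theta>: "0 < \<theta>" "\<theta> \<le> 1"
    and A: "\<And>l. A l \<in> sets M" "\<And>l. 0 < measure M (A l)"
    and lim: "weak_conv
           (\<lambda>l t. \<P>(x in M. ereal (measure M (A l)) * ereal_of_enat (hitting_time T (A l) x) \<le> ereal t))
           (\<lambda>t. if t < 0 then 0 else 1 - exp (- \<theta> * t))"
    and \<delta>: "0 < \<delta>" and \<epsilon>: "0 < \<epsilon>"
  shows "\<forall>\<^sub>F l in sequentially. \<forall>k. \<delta> \<le> measure M (A l) * real k \<and> measure M (A l) * real k \<le> 1 / \<delta> \<longrightarrow>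
           \<bar>\<P>(x in M. hitting_time T (A l) x = enat k)
             - \<theta> * exp (- \<theta> * (measure M (A l) * real k)) * measure M (A l)\<bar> \<le> \<epsilon> * measure M (A l)"
proof (rule exponential_local_limit[OF \<theta> A(2) _ _ _ \<delta> \<epsilon>])
  interpret prob_space M by fact
  have [measurable]: "hitting_time T (A l) \<in> measurable M (count_space UNIV)" for l
    using T(1) A(1) by (rule measurable_hitting_time)
  let ?p = "\<lambda>l k. \<P>(x in M. hitting_time T (A l) x = enat k)"
  show "0 \<le> ?p l n" for l n
    by simp
  \<comment> \<open>A first visit at time \<open>k + 1\<close> is a first visit at time
    \<open>k\<close> for the image point. For \<open>k = 0\<close> the inequality is false, as the
    hitting time never takes the value 0.\<close>
  have step: "?p l (Suc k) \<le> ?p l k" if "1 \<le> k" for l k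
  proof -
    have "?p l (Suc k) \<le> prob (T -` {x \<in> space M. hitting_time T (A l) x = enat k} \<inter> space M)"
    proof (rule finite_measure_mono)
      show "{x \<in> space M. hitting_time T (A l) x = enat (Suc k)}
          \<subseteq> T -` {x \<in> space M. hitting_time T (A l) x = enat k} \<inter> space M"
        using hitting_time_shift[of T "A l" _ "Suc k" 1] that measurable_space[OF T(1)] by auto
    qed (use T(1) in \<open>measurable\<close>)
    also have "\<dots> = measure (distr M M T) {x \<in> space M. hitting_time T (A l) x = enat k}"
      by (rule measure_distr[symmetric, OF T(1)]) measurable
    finally show ?thesis
      by (simp add: T(2))
  qed
  show "?p l j \<le> ?p l i" if "1 \<le> i" "i \<le> j" for l i j
    using that(2)
  proof (induction j rule: dec_induct)
    case (step n)
    with \<open>1 \<le> i\<close> show ?case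
      using \<open>\<And>l k. 1 \<le> k \<Longrightarrow> ?p l (Suc k) \<le> ?p l k\<close>[of n l] by linarith
  qed simp
  fix t :: real assume "0 \<le> t"
  \<comment> \<open>Written with \<open>max\<close>, the limit function is visibly continuous at 0
    too, so weak convergence is pointwise convergence at every nonnegative \<open>t\<close>.\<close>
  have "(\<lambda>t. if t < 0 then 0 else 1 - exp (- \<theta> * t)) = (\<lambda>t. 1 - exp (- \<theta> * max 0 t))"
    by (auto simp: fun_eq_iff max_def)
  moreover have "isCont (\<lambda>t. 1 - exp (- \<theta> * max 0 t)) t"
    by (intro continuous_intros)
  ultimately have "isCont (\<lambda>t. if t < 0 then 0 else 1 - exp (- \<theta> * t)) t"
    by (simp only:)
  then have "(\<lambda>l. \<P>(x in M. ereal (measure M (A l)) * ereal_of_enat (hitting_time T (A l) x) \<le> ereal t))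
      \<longlonglongrightarrow> (if t < 0 then 0 else 1 - exp (- \<theta> * t))"
    using lim unfolding weak_conv_def by blast
  then have "(\<lambda>l. \<P>(x in M. ereal (measure M (A l)) * ereal_of_enat (hitting_time T (A l) x) \<le> ereal t))
      \<longlonglongrightarrow> 1 - exp (- \<theta> * t)"
    using \<open>0 \<le> t\<close> by simp
  moreover have "\<P>(x in M. ereal (measure M (A l)) * ereal_of_enat (hitting_time T (A l) x) \<le> ereal t)
      = (\<Sum>i\<in>{1..nat \<lfloor>t / measure M (A l)\<rfloor>}. ?p l i)" for l
  proof -
    let ?n = "nat \<lfloor>t / measure M (A l)\<rfloor>"
    have iff: "ereal (measure M (A l)) * ereal_of_enat a \<le> ereal t \<longleftrightarrow> a \<le> enat ?n" for a
    proof (cases a)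
      case (enat n)
      then have "ereal (measure M (A l)) * ereal_of_enat a \<le> ereal t \<longleftrightarrow> real n \<le> t / measure M (A l)"
        using A(2)[of l] by (simp add: field_simps)
      also have "\<dots> \<longleftrightarrow> n \<le> ?n"
        using \<open>0 \<le> t\<close> A(2)[of l] by (simp add: le_nat_iff le_floor_iff)
      finally show ?thesis
        using enat by simp
    next
      case infinity
      then show ?thesis using A(2)[of l] by simp
    qed
    have "{x \<in> space M. hitting_time T (A l) x \<le> enat ?n}
        = (\<Union>i\<in>{1..?n}. {x \<in> space M. hitting_time T (A l) x = enat i})"
    proof (intro equalityI subsetI)
      fix x assume "x \<in> {x \<in> space M. hitting_time T (A l) x \<le> enat ?n}"
      moreover from this obtain i where "hitting_time T (A l) x = enat i"
        by (cases "hitting_time T (A l) x") auto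
      ultimately show "x \<in> (\<Union>i\<in>{1..?n}. {x \<in> space M. hitting_time T (A l) x = enat i})"
        using enat_eq_hitting_time_iff[of T "A l" x i] by auto
    qed auto
    then have "prob {x \<in> space M. hitting_time T (A l) x \<le> enat ?n} = (\<Sum>i\<in>{1..?n}. ?p l i)"
      by (simp only:, intro finite_measure_finite_Union) (auto simp: disjoint_family_on_def)
    then show ?thesis
      by (simp only: iff)
  qed
  ultimately show "(\<lambda>l. \<Sum>i\<in>{1..nat \<lfloor>t / measure M (A l)\<rfloor>}. ?p l i) \<longlonglongrightarrow> 1 - exp (- \<theta> * t)"
    by simp
qed

section \<open>Uniformity over scales, and hitting times after a delay\<close>

text \<open>The bad scales at the indices where the estimate fails can be collected into one sequence
  in \<^const>\<open>scale_seqs_delta\<close>; this is why pointwise-in-\<open>k\<close> hypotheses are automatically uniform.\<close>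

lemma uniformly_smallo_scale_seqs:
  assumes small: "\<And>k. k \<in> scale_seqs M A \<Longrightarrow> uniformly_smallo P (\<lambda>p l. f p l (k l)) b"
    and \<delta>: "\<delta> \<in> {0<..1}" and k0: "k0 \<in> scale_seqs_delta M A \<delta>" and "0 < \<epsilon>"
  shows "\<forall>\<^sub>F l in sequentially. \<forall>n. \<delta> \<le> measure M (A l) * real n \<and> measure M (A l) * real n \<le> 1 / \<delta> \<longrightarrow>
           (\<forall>p\<in>P. \<bar>f p l n\<bar> \<le> \<epsilon> * b l)"
proof -
  let ?adm = "\<lambda>l n. \<delta> \<le> measure M (A l) * real n \<and> measure M (A l) * real n \<le> 1 / \<delta>"
  let ?bad = "\<lambda>l n. ?adm l n \<and> \<not> (\<forall>p\<in>P. \<bar>f p l n\<bar> \<le> \<epsilon> * b l)"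
  \<comment> \<open>\<open>k0\<close> fills the indices without a bad scale. It has to be supplied,
    because for \<delta> near 1 the window may contain no multiple of
    \<open>measure M (A l)\<close>.\<close>
  define k where "k l = (if \<exists>n. ?bad l n then SOME n. ?bad l n else k0 l)" for l
  have bad: "?bad l (k l)" if "?bad l n" for l n
    unfolding k_def using that someI[of "?bad l" n] by auto
  have "?adm l (k l)" for l
  proof (cases "\<exists>n. ?bad l n")
    case True
    then show ?thesis using bad by blast
  next
    case False
    then show ?thesis using k0 by (auto simp: k_def scale_seqs_delta_def)
  qed
  then have "k \<in> scale_seqs M A"
    using \<delta> unfolding scale_seqs_def scale_seqs_delta_def by blast
  then obtain l0 where "\<forall>l\<ge>l0. \<forall>p\<in>P. \<bar>f p l (k l)\<bar> \<le> \<epsilon> * b l"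
    using small \<open>0 < \<epsilon>\<close> unfolding uniformly_smallo_def by blast
  then show ?thesis
    unfolding eventually_sequentially using bad by blast
qed

text \<open>\<open>B j\<close> is the set of points with delay \<open>j\<close>. On it the event of
  a first hit at \<open>k\<close> is compared with the event that \<open>(T ^^ j) x\<close> first
  hits at \<open>k - j\<close>. Summing over \<open>j\<close> gives total error \<open>c\<close>,
  while \<open>E\<close> collects the points that return within their delay and \<open>rest\<close>
  bounds the mass without an admissible delay.\<close>

lemma (in prob_space) delayed_hitting_estimate:
  fixes B :: "nat \<Rightarrow> 'a set"
  assumes J: "finite J" "\<And>j. j \<in> J \<Longrightarrow> j < k"
    and B: "\<And>j. j \<in> J \<Longrightarrow> B j \<in> events" "disjoint_family_on B J"
    and H: "{x \<in> space M. hitting_time T A x = enat k} \<in> events"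
    and HJ: "\<And>j. j \<in> J \<Longrightarrow> {x \<in> space M. hitting_time T A ((T ^^ j) x) = enat (k - j)} \<in> events"
    and E: "E \<in> events" "prob E \<le> \<eta>"
      "\<And>j x. j \<in> J \<Longrightarrow> x \<in> B j \<Longrightarrow> hitting_time T A x \<le> enat j \<Longrightarrow> (T ^^ k) x \<in> A \<Longrightarrow> x \<in> E"
    and rest: "prob (space M - (\<Union>j\<in>J. B j)) \<le> \<eta>"
    and p: "0 \<le> p" "p \<le> 1" and "0 \<le> c"
    and close: "\<And>j. j \<in> J \<Longrightarrow>
      \<bar>prob (B j \<inter> {x \<in> space M. hitting_time T A ((T ^^ j) x) = enat (k - j)}) - prob (B j) * p\<bar>
        \<le> c * prob (B j)"
  shows "\<bar>prob {x \<in> space M. hitting_time T A x = enat k} - p\<bar> \<le> c + 2 * \<eta>"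
proof -
  define H where "H = {x \<in> space M. hitting_time T A x = enat k}"
  define C where "C j = B j \<inter> {x \<in> space M. hitting_time T A ((T ^^ j) x) = enat (k - j)}" for j
  define U where "U = (\<Union>j\<in>J. B j)"
  define D where "D = (\<Union>j\<in>J. C j)"
  have C: "C j \<in> events" if "j \<in> J" for j
    using that B(1) HJ by (auto simp: C_def)
  have [measurable]: "H \<in> events" "U \<in> events" "D \<in> events" "E \<in> events"
    using J(1) B(1) C E(1) H by (auto simp: U_def D_def H_def)
  have U: "prob U = (\<Sum>j\<in>J. prob (B j))"
    unfolding U_def using J(1) B by (intro finite_measure_finite_Union) auto
  have D: "prob D = (\<Sum>j\<in>J. prob (C j))"
    unfolding D_def using J(1) B(2) C
    by (intro finite_measure_finite_Union) (auto simp: C_def disjoint_family_on_def)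
  have "\<bar>prob D - prob U * p\<bar> = \<bar>\<Sum>j\<in>J. prob (C j) - prob (B j) * p\<bar>"
    by (simp add: U D sum_subtractf sum_distrib_right)
  also have "\<dots> \<le> (\<Sum>j\<in>J. c * prob (B j))"
    using close by (intro order_trans[OF sum_abs] sum_mono) (simp add: C_def)
  also have "\<dots> = c * prob U"
    by (simp add: U sum_distrib_left)
  also have "\<dots> \<le> c"
    using \<open>0 \<le> c\<close> by (simp add: mult_left_le)
  finally have D_close: "\<bar>prob D - prob U * p\<bar> \<le> c" .
  have U_compl: "prob (space M - U) = 1 - prob U"
    by (simp add: prob_compl)
  \<comment> \<open>The pieces cover only \<open>U\<close>, so the sum approximates
    \<open>prob U * p\<close>; as \<open>p \<le> 1\<close>, this differs from \<open>p\<close> by at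
    most the uncovered mass.\<close>
  have "(1 - prob U) * p \<le> (1 - prob U) * 1"
    using p by (intro mult_left_mono) auto
  moreover have "prob U * p \<le> p"
    using p by (simp add: mult_left_le_one_le)
  ultimately have Up: "p - \<eta> \<le> prob U * p" "prob U * p \<le> p"
    using rest unfolding U_def[symmetric] U_compl by (simp_all add: algebra_simps)
  have split: "prob H = prob (H \<inter> U) + prob (H - U)"
    by (subst finite_measure_Union[symmetric]) (auto simp: Int_Diff_Un)
  have "prob (H - U) \<le> prob (space M - U)"
    using sets.sets_into_space[OF \<open>H \<in> events\<close>] by (intro finite_measure_mono) auto
  then have HU: "prob (H - U) \<le> \<eta>"
    using rest by (simp add: U_def)
  have "H \<inter> U \<subseteq> D"
    using J(2) hitting_time_shift[of T A _ k] by (auto simp: H_def U_def D_def C_def)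
  then have lower: "prob (H \<inter> U) \<le> prob D"
    by (intro finite_measure_mono) auto
  \<comment> \<open>The shift is one-sided: it can add only points that return by time
    \<open>j\<close> and still visit \<open>A\<close> at time \<open>k\<close>, and these lie in
    \<open>E\<close>.\<close>
  have "D \<subseteq> (H \<inter> U) \<union> E"
    using J(2) hitting_time_unshift[of T A _ _ k] E(3) by (fastforce simp: H_def U_def D_def C_def)
  then have "prob D \<le> prob ((H \<inter> U) \<union> E)"
    by (intro finite_measure_mono) auto
  also have "\<dots> \<le> prob (H \<inter> U) + prob E"
    by (intro measure_Un_le) auto
  \<comment> \<open>The lower bound pays \<eta> twice, for the uncovered mass and for
    \<open>E\<close>; the upper bound pays it once, for \<open>H - U\<close>.\<close>
  finally show ?thesis
    using D_close Up split HU lower E(2) measure_nonneg[of M "H - U"] unfolding H_def by linarith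
qed

section \<open>Conditioned measures and measures carried by a subset\<close>

lemma cond_measure_simps [simp]:
  "sets (cond_measure \<nu> B) = sets \<nu>" "space (cond_measure \<nu> B) = space \<nu>"
  by (simp_all add: cond_measure_def)

lemma (in finite_measure)
  assumes "0 < measure M B"
  shows measure_cond_measure: "E \<in> sets M \<Longrightarrow> measure (cond_measure M B) E = measure M (B \<inter> E) / measure M B"
    and prob_space_cond_measure: "prob_space (cond_measure M B)"
  using assms
  by (auto simp: cond_measure_def emeasure_eq_measure intro!: measure_uniform_measure prob_space_uniform_measure)

text \<open>Null sets of the conditioned measure are null within \<open>B\<close> for the original
  one. If \<open>B\<close> has measure zero, the conditioned measure is zero and its essential
  supremum carries no information, but then almost no point lies in \<open>B\<close>.\<close>

lemma (in finite_measure) AE_bounded_on_esssup_cond_measure: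
  fixes f :: "'a \<Rightarrow> ennreal"
  assumes "B \<in> sets M"
  shows "AE x in M. x \<in> B \<longrightarrow> f x \<le> esssup (cond_measure M B) (\<lambda>x. indicator B x * f x)"
proof (cases "0 < measure M B")
  case True
  define s where "s = esssup (cond_measure M B) (\<lambda>x. indicator B x * f x)"
  have eq: "cond_measure M B = uniform_measure M B"
    using True by (simp add: cond_measure_def)
  have ae: "AE x in uniform_measure M B. indicator B x * f x \<le> s"
    unfolding s_def eq by (rule esssup_AE)
  have B: "emeasure M B \<noteq> 0" "emeasure M B < \<infinity>"
    using True by (simp_all add: emeasure_eq_measure)
  have "AE x in M. x \<in> B \<longrightarrow> indicator B x * f x \<le> s"
    by (rule AE_uniform_measure[OF B, THEN iffD1, OF ae])
  then have "AE x in M. x \<in> B \<longrightarrow>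
      indicator B x * f x \<le> esssup (cond_measure M B) (\<lambda>x. indicator B x * f x)"
    by (simp only: s_def)
  then show ?thesis
    by eventually_elim auto
next
  case False
  then have "B \<in> null_sets M"
    using assms measure_nonneg[of M B] by (auto simp: emeasure_eq_measure null_sets_def not_less)
  then have "AE x in M. x \<notin> B"
    by (rule AE_not_in)
  then show ?thesis
    by eventually_elim simp
qed

lemma SUP_ennreal_tendsto_0_imp_eventually_less:
  assumes lim: "(\<lambda>l. SUP x\<in>X l. ennreal (g l x)) \<longlonglongrightarrow> 0" and "0 < \<eta>"
  shows "\<forall>\<^sub>F l in sequentially. \<forall>x\<in>X l. g l x < \<eta>"
proof -
  have "\<forall>\<^sub>F l in sequentially. (SUP x\<in>X l. ennreal (g l x)) < ennreal \<eta>"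
    using order_tendstoD(2)[OF lim] \<open>0 < \<eta>\<close> by simp
  then show ?thesis
  proof eventually_elim
    case (elim l)
    show ?case
    proof
      fix x assume "x \<in> X l"
      then have "ennreal (g l x) < ennreal \<eta>"
        using elim by (meson SUP_upper le_less_trans)
      then show "g l x < \<eta>"
        by (meson ennreal_leI not_less)
    qed
  qed
qed

context
  fixes M :: "'a measure" and A \<nu>
  assumes A: "A \<in> sets M" and \<nu>: "\<nu> \<in> prob_measures_on (restrict_space M A)"
begin

lemma prob_measures_on_restrict_space:
  shows "prob_space \<nu>" and "space \<nu> = A" and "E \<in> sets \<nu> \<longleftrightarrow> E \<subseteq> A \<and> E \<in> sets M"
  using \<nu> A sets.sets_into_space[OF A]
  by (auto simp: prob_measures_on_def space_restrict_space sets_restrict_space_iff)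

lemma measurable_prob_measures_on_restrict_space:
  "f \<in> measurable M L \<Longrightarrow> f \<in> measurable \<nu> L"
  using \<nu> measurable_cong_sets[of \<nu> "restrict_space M A" L L]
  by (auto simp: prob_measures_on_def measurable_restrict_space1)

end

section \<open>The local limit law under measures carried by the target sets\<close>

text \<open>All errors are additive and small compared with \<open>measure M (A l)\<close>. They
  become relative errors because the limit density is bounded away from 0 for times at a fixed scale
  \<delta>.\<close>

lemma asymp_equiv_of_LLT_circ:
  fixes M :: "'a measure" and T :: "'a \<Rightarrow> 'a" and \<theta> :: real
  assumes "prob_space M" and T: "T \<in> measurable M M"
    and \<theta>: "0 < \<theta>" "\<theta> \<le> 1"
    and A: "\<And>l. A l \<in> sets M" "\<And>l. 0 < measure M (A l)"
    and sets: "\<And>l. Ab l \<in> sets M" "\<And>l. Ac l \<in> sets M"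
    and A_eq: "\<And>l. A l = Ab l \<union> Ac l" and disj: "\<And>l. Ab l \<inter> Ac l = {}"
    and local_limit: "\<And>\<delta> \<epsilon>. 0 < \<delta> \<Longrightarrow> 0 < \<epsilon> \<Longrightarrow>
        \<forall>\<^sub>F l in sequentially. \<forall>k. \<delta> \<le> measure M (A l) * real k \<and> measure M (A l) * real k \<le> 1 / \<delta> \<longrightarrow>
           \<bar>\<P>(x in M. hitting_time T (A l) x = enat k)
             - \<theta> * exp (- \<theta> * (measure M (A l) * real k)) * measure M (A l)\<bar> \<le> \<epsilon> * measure M (A l)"
    and V: "\<And>l. V l \<subseteq> prob_measures_on (restrict_space M (A l))"
    and circ: "(\<lambda>l. SUP \<nu>\<in>V l. ennreal \<bar>measure \<nu> (Ac l) - \<theta>\<bar>) \<longlonglongrightarrow> 0"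
    and bullet: "(\<lambda>l. emeasure M (A l) *
           (SUP \<nu>\<in>V l. esssup (cond_measure \<nu> (Ab l))
              (\<lambda>x. indicator (Ab l) x * ennreal_of_enat (hitting_time T (A l) x)))) \<longlonglongrightarrow> 0"
    and LLT: "LLT_circ M T A Ac V"
    and \<delta>: "\<delta> \<in> {0<..1}"
  shows "uniformly_asymp_equiv (Pi UNIV V \<times> scale_seqs_delta M A \<delta>)
             (\<lambda>(\<nu>, k) l. \<P>(x in \<nu> l. hitting_time T (A l) x = enat (k l)))
             (\<lambda>(\<nu>, k) l. \<theta>\<^sup>2 * exp (- \<theta> * measure M (A l) * real (k l)) * measure M (A l))"
\<comment> \<open>With no admissible sequence the claim is vacuous; otherwise any one of them can
  serve as \<open>k0\<close> when bad scales are collected.\<close>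
proof (cases "scale_seqs_delta M A \<delta> = {}")
  case True
  then show ?thesis by (simp add: uniformly_asymp_equiv_def)
next
  case False
  interpret prob_space M by fact
  obtain k0 where k0: "k0 \<in> scale_seqs_delta M A \<delta>"
    using False by blast
  define m where "m l = measure M (A l)" for l
  define S where "S l = (SUP \<nu>\<in>V l. esssup (cond_measure \<nu> (Ab l))
              (\<lambda>x. indicator (Ab l) x * ennreal_of_enat (hitting_time T (A l) x)))" for l
  have "\<forall>\<^sub>F l in sequentially. \<forall>p\<in>Pi UNIV V \<times> scale_seqs_delta M A \<delta>.
      \<bar>(case p of (\<nu>, k) \<Rightarrow> \<lambda>l. \<P>(x in \<nu> l. hitting_time T (A l) x = enat (k l))) l /
       (case p of (\<nu>, k) \<Rightarrow> \<lambda>l. \<theta>\<^sup>2 * exp (- \<theta> * m l * real (k l)) * m l) l - 1\<bar> \<le> \<epsilon>"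
    if "0 < \<epsilon>" for \<epsilon>
  proof -
    \<comment> \<open>\<open>c\<close> is the least value of the limit density on the window. Three
      errors of size \<eta> occur: in the local limit, in the comparison with the conditioned
      measure, and in the mass of \<open>Ac l\<close>. Since \<open>\<eta> < \<theta>\<close>, that
      mass is positive and conditioning on \<open>Ac l\<close> is genuine.\<close>
    define c where "c = \<theta>\<^sup>2 * exp (- \<theta> * (1 / \<delta>))"
    define \<eta> where "\<eta> = min (\<theta> / 2) (\<epsilon> * c / 3)"
    have "0 < c"
      using \<theta> by (simp add: c_def)
    then have \<eta>: "0 < \<eta>" "\<eta> < \<theta>" "3 * \<eta> \<le> \<epsilon> * c"
      using \<theta> \<open>0 < \<epsilon>\<close> by (auto simp: \<eta>_def)
    have "\<forall>\<^sub>F l in sequentially. \<forall>\<nu>\<in>V l. \<bar>measure \<nu> (Ac l) - \<theta>\<bar> < \<eta>"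
      using circ \<eta>(1) by (rule SUP_ennreal_tendsto_0_imp_eventually_less)
    \<comment> \<open>The bound lies strictly below the lower end of the window, so almost no point
      of \<open>Ab l\<close> can have a hitting time \<open>k l\<close> with
      \<open>measure M (A l) * k l\<close> at least \<delta>.\<close>
    moreover have "\<forall>\<^sub>F l in sequentially. emeasure M (A l) * S l < ennreal \<delta>"
      using order_tendstoD(2)[OF bullet, of "ennreal \<delta>"] \<delta> by (simp add: S_def)
    moreover have "\<forall>\<^sub>F l in sequentially. \<forall>k. \<delta> \<le> measure M (A l) * real k \<and> measure M (A l) * real k \<le> 1 / \<delta> \<longrightarrow>
           \<bar>\<P>(x in M. hitting_time T (A l) x = enat k)
             - \<theta> * exp (- \<theta> * (measure M (A l) * real k)) * measure M (A l)\<bar> \<le> \<eta> * measure M (A l)"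
      using local_limit \<delta> \<eta>(1) by simp
    moreover have "\<forall>\<^sub>F l in sequentially. \<forall>n. \<delta> \<le> measure M (A l) * real n \<and> measure M (A l) * real n \<le> 1 / \<delta> \<longrightarrow>
           (\<forall>\<nu>\<in>Pi UNIV V. \<bar>\<bar>\<P>(x in cond_measure (\<nu> l) (Ac l). hitting_time T (A l) x = enat n)
                 - \<P>(x in M. hitting_time T (A l) x = enat n)\<bar>\<bar> \<le> \<eta> * measure M (A l))"
      using LLT unfolding LLT_circ_def
      by (intro uniformly_smallo_scale_seqs[OF _ \<delta> k0 \<eta>(1)]) blast
    ultimately show ?thesis
    proof (eventually_elim, intro ballI, elim SigmaE, hypsubst, simp only: prod.case)
      fix l \<nu> k
      assume circ_l: "\<forall>\<nu>\<in>V l. \<bar>measure \<nu> (Ac l) - \<theta>\<bar> < \<eta>"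
        and bullet_l: "emeasure M (A l) * S l < ennreal \<delta>"
        and limit_l: "\<forall>k. \<delta> \<le> measure M (A l) * real k \<and> measure M (A l) * real k \<le> 1 / \<delta> \<longrightarrow>
           \<bar>\<P>(x in M. hitting_time T (A l) x = enat k)
             - \<theta> * exp (- \<theta> * (measure M (A l) * real k)) * measure M (A l)\<bar> \<le> \<eta> * measure M (A l)"
        and LLT_l: "\<forall>n. \<delta> \<le> measure M (A l) * real n \<and> measure M (A l) * real n \<le> 1 / \<delta> \<longrightarrow>
           (\<forall>\<nu>\<in>Pi UNIV V. \<bar>\<bar>\<P>(x in cond_measure (\<nu> l) (Ac l). hitting_time T (A l) x = enat n)
                 - \<P>(x in M. hitting_time T (A l) x = enat n)\<bar>\<bar> \<le> \<eta> * measure M (A l))"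
        and \<nu>: "\<nu> \<in> Pi UNIV V" and k: "k \<in> scale_seqs_delta M A \<delta>"
      have scale: "\<delta> \<le> m l * real (k l)" "m l * real (k l) \<le> 1 / \<delta>"
        using k by (auto simp: scale_seqs_delta_def m_def)
      have "\<nu> l \<in> V l"
        using \<nu> by auto
      then have \<nu>l: "\<nu> l \<in> prob_measures_on (restrict_space M (A l))"
        using V by blast
      interpret N: prob_space "\<nu> l"
        using A(1) \<nu>l by (rule prob_measures_on_restrict_space)
      note space = prob_measures_on_restrict_space(2)[OF A(1) \<nu>l]
        and sets_iff = prob_measures_on_restrict_space(3)[OF A(1) \<nu>l]
      have [measurable]: "hitting_time T (A l) \<in> measurable (\<nu> l) (count_space UNIV)"
        using A(1) \<nu>l measurable_hitting_time[OF T A(1)]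
        by (rule measurable_prob_measures_on_restrict_space)
      define H where "H = {x \<in> space (\<nu> l). hitting_time T (A l) x = enat (k l)}"
      have [measurable]: "H \<in> N.events"
        unfolding H_def by measurable
      have [measurable]: "Ab l \<in> N.events" "Ac l \<in> N.events"
        using sets A_eq[of l] by (auto simp: sets_iff)
      define q where "q = \<P>(x in cond_measure (\<nu> l) (Ac l). hitting_time T (A l) x = enat (k l))"
      define p where "p = \<P>(x in M. hitting_time T (A l) x = enat (k l))"
      define g where "g = \<theta> * exp (- \<theta> * (m l * real (k l)))"
      define a where "a = N.prob (Ac l)"
      have a: "\<bar>a - \<theta>\<bar> < \<eta>" "0 < a" "a \<le> 1"
        using circ_l \<open>\<nu> l \<in> V l\<close> \<eta>(2) by (force simp: a_def)+
      have g: "0 \<le> g" "g \<le> 1"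
        using \<theta> A(2)[of l] by (auto simp: g_def m_def intro!: mult_le_one)
      have "q = N.prob (Ac l \<inter> H) / a"
        using a(2) N.measure_cond_measure[of "Ac l" H] by (simp add: q_def a_def H_def)
      then have Ac_H: "N.prob (Ac l \<inter> H) = a * q"
        using a(2) by simp
      have "AE x in \<nu> l. x \<in> Ab l \<longrightarrow> ennreal_of_enat (hitting_time T (A l) x)
          \<le> esssup (cond_measure (\<nu> l) (Ab l))
              (\<lambda>x. indicator (Ab l) x * ennreal_of_enat (hitting_time T (A l) x))"
        by (rule N.AE_bounded_on_esssup_cond_measure) simp
      then have "AE x in \<nu> l. x \<notin> Ab l \<inter> H"
      proof (eventually_elim, intro notI)
        fix x
        assume le: "x \<in> Ab l \<longrightarrow> ennreal_of_enat (hitting_time T (A l) x)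
          \<le> esssup (cond_measure (\<nu> l) (Ab l))
              (\<lambda>x. indicator (Ab l) x * ennreal_of_enat (hitting_time T (A l) x))"
          and x: "x \<in> Ab l \<inter> H"
        have "of_nat (k l) \<le> esssup (cond_measure (\<nu> l) (Ab l))
              (\<lambda>x. indicator (Ab l) x * ennreal_of_enat (hitting_time T (A l) x))"
          using le x by (simp add: H_def)
        also have "\<dots> \<le> S l"
          unfolding S_def by (rule SUP_upper[OF \<open>\<nu> l \<in> V l\<close>])
        finally have "emeasure M (A l) * of_nat (k l) \<le> emeasure M (A l) * S l"
          by (rule mult_left_mono) simp
        also have "\<dots> < ennreal \<delta>"
          by (rule bullet_l)
        finally have "ennreal (m l * real (k l)) < ennreal \<delta>"
          by (simp add: emeasure_eq_measure m_def ennreal_mult ennreal_of_nat_eq_real_of_nat)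
        then show False
          using scale(1) by (meson ennreal_leI not_less)
      qed
      then have Ab_H: "N.prob (Ab l \<inter> H) = 0"
        by (intro measure_eq_0_null_sets) (simp add: AE_iff_null_sets)
      have "H = (Ac l \<inter> H) \<union> (Ab l \<inter> H)"
        using A_eq[of l] by (auto simp: H_def space)
      then have "N.prob H = N.prob (Ac l \<inter> H) + N.prob (Ab l \<inter> H)"
        using disj[of l] by (subst N.finite_measure_Union[symmetric]) auto
      then have H: "N.prob H = a * q"
        by (simp add: Ac_H Ab_H)
      have "\<bar>q - p\<bar> \<le> \<eta> * m l"
        using LLT_l[rule_format, of "k l" \<nu>] \<nu> scale by (simp add: q_def p_def m_def)
      moreover have "\<bar>p - g * m l\<bar> \<le> \<eta> * m l"
        using limit_l[rule_format, of "k l"] scale by (simp add: p_def g_def m_def)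
      ultimately have "\<bar>q - g * m l\<bar> \<le> 2 * \<eta> * m l"
        by linarith
      then have close: "a * \<bar>q - g * m l\<bar> \<le> 1 * (2 * \<eta> * m l)"
        using a by (intro mult_mono) auto
      have close':  "\<bar>a - \<theta>\<bar> * (g * m l) \<le> \<eta> * (1 * m l)"
        using a g A(2)[of l] \<eta> by (intro mult_mono mult_right_mono) (auto simp: m_def)
      have "\<theta> * (m l * real (k l)) \<le> \<theta> * (1 / \<delta>)"
        using \<theta>(1) scale(2) by (intro mult_left_mono) auto
      then have c_le: "c \<le> \<theta> * g"
        using \<theta>(1) by (simp add: c_def g_def power2_eq_square)
      \<comment> \<open>First \<open>q\<close> is replaced by \<open>g * m l\<close> at cost
        \<open>2 * \<eta> * m l\<close>, then \<open>a\<close> by \<theta> at cost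
        \<open>\<eta> * m l\<close>, using \<open>a \<le> 1\<close> and
        \<open>g \<le> 1\<close>.\<close>
      have "a * q - \<theta> * g * m l = a * (q - g * m l) + (a - \<theta>) * (g * m l)"
        by (simp add: algebra_simps)
      also have "\<bar>\<dots>\<bar> \<le> a * \<bar>q - g * m l\<bar> + \<bar>a - \<theta>\<bar> * (g * m l)"
        using abs_triangle_ineq[of "a * (q - g * m l)" "(a - \<theta>) * (g * m l)"] a(2) g(1)
        by (simp add: abs_mult m_def)
      also have "\<dots> \<le> 3 * \<eta> * m l"
        using close close' by linarith
      also have "\<dots> \<le> \<epsilon> * c * m l"
        using \<eta>(3) A(2)[of l] by (simp add: m_def)
      also have "\<dots> \<le> \<epsilon> * (\<theta> * g) * m l"
        using c_le \<open>0 < \<epsilon>\<close> A(2)[of l] by (simp add: m_def)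
      finally have est: "\<bar>N.prob H - \<theta> * g * m l\<bar> \<le> \<epsilon> * (\<theta> * g * m l)"
        by (simp add: H mult.assoc)
      have pos: "0 < \<theta> * g * m l"
        using \<theta> A(2)[of l] by (simp add: g_def m_def)
      have "N.prob H / (\<theta> * g * m l) - 1 = (N.prob H - \<theta> * g * m l) / (\<theta> * g * m l)"
        using pos by (auto simp: diff_divide_distrib)
      then have "\<bar>N.prob H / (\<theta> * g * m l) - 1\<bar> \<le> \<epsilon>"
        using est pos by (simp add: abs_divide divide_le_eq)
      then show "\<bar>\<P>(x in \<nu> l. hitting_time T (A l) x = enat (k l))
          / (\<theta>\<^sup>2 * exp (- \<theta> * m l * real (k l)) * m l) - 1\<bar> \<le> \<epsilon>"
        by (simp add: H_def g_def power2_eq_square mult.assoc)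
    qed
  qed
  then show ?thesis
    unfolding uniformly_asymp_equiv_def m_def by (simp add: eventually_sequentially)
qed

section \<open>The criterion by delays\<close>

text \<open>\<open>delayed_hitting_estimate\<close> is applied to the measure conditioned on
  \<open>Ac l\<close>, with pieces given by the values of \<open>\<tau> l\<close>. On a piece the
  shifted event is measured by a member of \<open>\<V>\<close> at time \<open>k l - j\<close>, and
  the local limit under \<open>M\<close> allows a return to time \<open>k l\<close>.\<close>

lemma LLT_circ_of_delay:
  fixes M :: "'a measure" and T :: "'a \<Rightarrow> 'a" and \<theta> :: real and \<tau> :: "nat \<Rightarrow> 'a \<Rightarrow> enat"
  assumes "prob_space M" and T: "T \<in> measurable M M"
    and \<theta>: "0 < \<theta>" "\<theta> \<le> 1"
    and A: "\<And>l. A l \<in> sets M" "\<And>l. 0 < measure M (A l)"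
    and Ac: "\<And>l. Ac l \<in> sets M" "\<And>l. Ac l \<subseteq> A l"
    and local_limit: "\<And>\<delta> \<epsilon>. 0 < \<delta> \<Longrightarrow> 0 < \<epsilon> \<Longrightarrow>
        \<forall>\<^sub>F l in sequentially. \<forall>k. \<delta> \<le> measure M (A l) * real k \<and> measure M (A l) * real k \<le> 1 / \<delta> \<longrightarrow>
           \<bar>\<P>(x in M. hitting_time T (A l) x = enat k)
             - \<theta> * exp (- \<theta> * (measure M (A l) * real k)) * measure M (A l)\<bar> \<le> \<epsilon> * measure M (A l)"
    and V: "\<And>l. V l \<subseteq> prob_measures_on (restrict_space M (A l))"
    and circ: "(\<lambda>l. SUP \<nu>\<in>V l. ennreal \<bar>measure \<nu> (Ac l) - \<theta>\<bar>) \<longlonglongrightarrow> 0"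
    and \<tau>: "\<And>l. \<tau> l \<in> measurable (restrict_space M (Ac l)) (count_space UNIV)"
    and \<tau>_small: "\<And>\<epsilon>. 0 < \<epsilon> \<Longrightarrow>
            uniformly_smallo (Pi UNIV V)
              (\<lambda>\<nu> l. measure (cond_measure (\<nu> l) (Ac l))
                 {x \<in> Ac l. ereal (measure M (A l)) * ereal_of_enat (\<tau> l x) > ereal \<epsilon>})
              (\<lambda>l. measure M (A l))"
    and LLT: "LLT_uniform M T A \<V>"
    and \<V>: "\<And>l \<nu> j. \<nu> \<in> V l \<Longrightarrow> measure (cond_measure \<nu> (Ac l)) {x \<in> Ac l. \<tau> l x = enat j} > 0 \<Longrightarrow>
            distr (cond_measure (cond_measure \<nu> (Ac l)) {x \<in> Ac l. \<tau> l x = enat j}) M (T ^^ j) \<in> \<V>"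
    and early: "\<And>k. k \<in> scale_seqs M A \<Longrightarrow>
            uniformly_smallo (Pi UNIV V)
              (\<lambda>\<nu> l. measure (cond_measure (\<nu> l) (Ac l))
                 {x \<in> Ac l. hitting_time T (A l) x \<le> \<tau> l x \<and> (T ^^ k l) x \<in> A l})
              (\<lambda>l. measure M (A l))"
  shows "LLT_circ M T A Ac V"
  unfolding LLT_circ_def uniformly_smallo_def
proof (intro ballI allI impI)
  interpret prob_space M by fact
  fix k and \<epsilon> :: real
  assume "k \<in> scale_seqs M A" and "0 < \<epsilon>"
  then obtain \<delta> where \<delta>: "0 < \<delta>" "\<delta> \<le> 1" and k: "k \<in> scale_seqs_delta M A \<delta>"
    by (auto simp: scale_seqs_def)
  define m where "m l = measure M (A l)" for l
  have m: "0 < m l" for l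
    using A(2) by (simp add: m_def)
  \<comment> \<open>\<open>h \<le> \<delta> / 2\<close> keeps \<open>k l - j\<close> in the window
    of scale \<open>\<delta> / 2\<close> for every delay \<open>j\<close> with
    \<open>m l * j \<le> h\<close>. The final error is \<open>5 * \<eta> + h\<close>, at most 7/8 of
    \<epsilon>.\<close>
  define h where "h = min (\<delta> / 2) (\<epsilon> / 4)"
  define \<eta> where "\<eta> = \<epsilon> / 8"
  have h: "0 < h" "h \<le> \<delta> / 2" "h \<le> \<epsilon> / 4" and \<eta>: "0 < \<eta>"
    using \<delta> \<open>0 < \<epsilon>\<close> by (auto simp: h_def \<eta>_def)
  have "1 / \<delta> \<le> 1 / (\<delta> / 2)"
    using \<delta> by (simp add: field_simps)
  moreover have "\<delta> \<le> m l * real (k l)" "m l * real (k l) \<le> 1 / \<delta>" for l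
    using k by (auto simp: scale_seqs_delta_def m_def)
  ultimately have half_scale: "\<delta> / 2 \<le> m l * real (k l)" "m l * real (k l) \<le> 1 / (\<delta> / 2)" for l
    using \<delta> by (smt (verit) field_sum_of_halves)+
  then have k': "k \<in> scale_seqs_delta M A (\<delta> / 2)"
    by (simp add: scale_seqs_delta_def m_def)
  have \<delta>': "\<delta> / 2 \<in> {0<..1}"
    using \<delta> by simp
  \<comment> \<open>Tolerance \<theta> suffices here: it makes the mass of \<open>Ac l\<close>
    positive, so the conditioned measure is a probability.\<close>
  have "\<forall>\<^sub>F l in sequentially. \<forall>\<nu>\<in>V l. \<bar>measure \<nu> (Ac l) - \<theta>\<bar> < \<theta>"
    using circ \<theta>(1) by (rule SUP_ennreal_tendsto_0_imp_eventually_less)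
  moreover have "\<forall>\<^sub>F l in sequentially. \<forall>n. \<delta> / 2 \<le> m l * real n \<and> m l * real n \<le> 1 / (\<delta> / 2) \<longrightarrow>
      \<bar>\<P>(x in M. hitting_time T (A l) x = enat n) - \<theta> * exp (- \<theta> * (m l * real n)) * m l\<bar> \<le> \<eta> * m l"
    unfolding m_def using half_gt_zero[OF \<delta>(1)] \<eta> by (rule local_limit)
  \<comment> \<open>The shifted time depends on the delay, so the estimate is required at all times
    of the wider window at once, not only along one sequence.\<close>
  moreover have "\<forall>\<^sub>F l in sequentially. \<forall>n. \<delta> / 2 \<le> measure M (A l) * real n \<and> measure M (A l) * real n \<le> 1 / (\<delta> / 2) \<longrightarrow>
      (\<forall>\<nu>\<in>\<V>. \<bar>\<bar>\<P>(x in \<nu>. hitting_time T (A l) x = enat n)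
          - \<P>(x in M. hitting_time T (A l) x = enat n)\<bar>\<bar> \<le> \<eta> * measure M (A l))"
    using LLT unfolding LLT_uniform_def
    by (intro uniformly_smallo_scale_seqs[OF _ \<delta>' k' \<eta>]) blast
  moreover have "\<forall>\<^sub>F l in sequentially. \<forall>\<nu>\<in>Pi UNIV V. \<bar>measure (cond_measure (\<nu> l) (Ac l))
      {x \<in> Ac l. ereal (m l) * ereal_of_enat (\<tau> l x) > ereal h}\<bar> \<le> \<eta> * m l"
    using \<tau>_small[OF h(1)] \<eta> unfolding uniformly_smallo_def eventually_sequentially m_def by blast
  moreover have "\<forall>\<^sub>F l in sequentially. \<forall>\<nu>\<in>Pi UNIV V. \<bar>measure (cond_measure (\<nu> l) (Ac l))
      {x \<in> Ac l. hitting_time T (A l) x \<le> \<tau> l x \<and> (T ^^ k l) x \<in> A l}\<bar> \<le> \<eta> * m l"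
    using early[OF \<open>k \<in> scale_seqs M A\<close>] \<eta>
    unfolding uniformly_smallo_def eventually_sequentially m_def by blast
  ultimately have "\<forall>\<^sub>F l in sequentially. \<forall>\<nu>\<in>Pi UNIV V.
      \<bar>\<P>(x in cond_measure (\<nu> l) (Ac l). hitting_time T (A l) x = enat (k l))
        - \<P>(x in M. hitting_time T (A l) x = enat (k l))\<bar> \<le> \<epsilon> * m l"
  proof (eventually_elim, intro ballI)
    fix l \<nu>
    assume circ_l: "\<forall>\<nu>\<in>V l. \<bar>measure \<nu> (Ac l) - \<theta>\<bar> < \<theta>"
      and limit_l: "\<forall>n. \<delta> / 2 \<le> m l * real n \<and> m l * real n \<le> 1 / (\<delta> / 2) \<longrightarrow>
        \<bar>\<P>(x in M. hitting_time T (A l) x = enat n) - \<theta> * exp (- \<theta> * (m l * real n)) * m l\<bar> \<le> \<eta> * m l"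
      and LLT_l: "\<forall>n. \<delta> / 2 \<le> measure M (A l) * real n \<and> measure M (A l) * real n \<le> 1 / (\<delta> / 2) \<longrightarrow>
        (\<forall>\<nu>\<in>\<V>. \<bar>\<bar>\<P>(x in \<nu>. hitting_time T (A l) x = enat n)
          - \<P>(x in M. hitting_time T (A l) x = enat n)\<bar>\<bar> \<le> \<eta> * measure M (A l))"
      and \<tau>_l: "\<forall>\<nu>\<in>Pi UNIV V. \<bar>measure (cond_measure (\<nu> l) (Ac l))
        {x \<in> Ac l. ereal (m l) * ereal_of_enat (\<tau> l x) > ereal h}\<bar> \<le> \<eta> * m l"
      and early_l: "\<forall>\<nu>\<in>Pi UNIV V. \<bar>measure (cond_measure (\<nu> l) (Ac l))
        {x \<in> Ac l. hitting_time T (A l) x \<le> \<tau> l x \<and> (T ^^ k l) x \<in> A l}\<bar> \<le> \<eta> * m l"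
      and \<nu>: "\<nu> \<in> Pi UNIV V"
    have scale: "\<delta> \<le> m l * real (k l)" "m l * real (k l) \<le> 1 / \<delta>"
      using k by (auto simp: scale_seqs_delta_def m_def)
    have "\<nu> l \<in> V l"
      using \<nu> by auto
    then have \<nu>l: "\<nu> l \<in> prob_measures_on (restrict_space M (A l))"
      using V by blast
    interpret \<nu>: prob_space "\<nu> l"
      using A(1) \<nu>l by (rule prob_measures_on_restrict_space)
    define N where "N = cond_measure (\<nu> l) (Ac l)"
    have Ac_pos: "0 < measure (\<nu> l) (Ac l)"
      using circ_l \<open>\<nu> l \<in> V l\<close> by force
    interpret N: prob_space N
      unfolding N_def using Ac_pos by (rule \<nu>.prob_space_cond_measure)
    have space: "space N = A l"
      using prob_measures_on_restrict_space(2)[OF A(1) \<nu>l] by (simp add: N_def)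
    have events: "E \<in> N.events \<longleftrightarrow> E \<subseteq> A l \<and> E \<in> sets M" for E
      using prob_measures_on_restrict_space(3)[OF A(1) \<nu>l] by (simp add: N_def)
    have meas_N: "f \<in> measurable N L" if "f \<in> measurable M L" for f and L :: "'c measure"
      using measurable_prob_measures_on_restrict_space[OF A(1) \<nu>l that]
      by (simp add: N_def cong: measurable_cong_sets)
    have hit [measurable]: "hitting_time T (A l) \<in> measurable M (count_space UNIV)"
      using T A(1) by (rule measurable_hitting_time)
    have T_pow [measurable]: "T ^^ j \<in> measurable M M" for j
      using T by (rule measurable_compose_n)
    have N_eq: "N.prob E = measure (\<nu> l) (Ac l \<inter> E) / measure (\<nu> l) (Ac l)" if "E \<in> N.events" for E
      using that \<nu>.measure_cond_measure[OF Ac_pos, of E] by (simp add: N_def)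
    define p where "p n = \<P>(x in M. hitting_time T (A l) x = enat n)" for n
    \<comment> \<open>The delays negligible at scale \<open>1 / m l\<close>; they stay below
      \<open>k l\<close>, which also makes \<open>J\<close> finite.\<close>
    define J where "J = {j. m l * real j \<le> h}"
    define B where "B j = {x \<in> Ac l. \<tau> l x = enat j}" for j
    define E where "E = {x \<in> Ac l. hitting_time T (A l) x \<le> \<tau> l x \<and> (T ^^ k l) x \<in> A l}"
    have J_k: "j < k l" if "j \<in> J" for j
    proof -
      have "m l * real j < m l * real (k l)"
        using that h \<delta> scale by (simp add: J_def)
      then show ?thesis
        using m[of l] by simp
    qed
    have "J \<subseteq> {..<k l}"
      using J_k by auto
    then have "finite J"
      by (rule finite_subset) simp
    have Ac_space: "space (restrict_space M (Ac l)) = Ac l"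
      using sets.sets_into_space[OF Ac(1)] by (auto simp: space_restrict_space)
    have Ac_sets: "F \<in> sets (restrict_space M (Ac l)) \<longleftrightarrow> F \<subseteq> Ac l \<and> F \<in> sets M" for F
      using sets.sets_into_space[OF Ac(1)] Ac(1) by (auto simp: sets_restrict_space_iff)
    have "B j \<in> sets (restrict_space M (Ac l))" for j
      using measurable_sets[OF \<tau>[of l], of "{enat j}"] by (simp add: Ac_space B_def vimage_def Int_def conj_commute)
    then have B: "B j \<in> N.events" for j
      using Ac(2)[of l] by (auto simp: Ac_sets events)
    have "{x \<in> space (restrict_space M (Ac l)). hitting_time T (A l) x \<le> \<tau> l x} \<in> sets (restrict_space M (Ac l))"
      by (intro sets_Collect_le_enat measurable_restrict_space1[OF hit] \<tau>)
    then have "{x \<in> Ac l. hitting_time T (A l) x \<le> \<tau> l x} \<in> sets M"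
      by (simp add: Ac_space Ac_sets)
    moreover have "(T ^^ k l) -` A l \<inter> space M \<in> sets M"
      using T_pow A(1) by (rule measurable_sets)
    moreover have "E = {x \<in> Ac l. hitting_time T (A l) x \<le> \<tau> l x} \<inter> ((T ^^ k l) -` A l \<inter> space M)"
      using sets.sets_into_space[OF Ac(1)[of l]] by (auto simp: E_def)
    ultimately have E: "E \<in> N.events"
      using Ac(2)[of l] by (auto simp: events E_def)
    \<comment> \<open>Per piece, \<eta> is paid for the member of \<open>\<V>\<close> at
      \<open>k l - j\<close> and for the local limit at \<open>k l - j\<close> and at
      \<open>k l\<close>, and \<open>h\<close> for the change of density. The last summand covers
      early returns and long delays.\<close>
    have "\<bar>N.prob {x \<in> space N. hitting_time T (A l) x = enat (k l)} - p (k l)\<bar>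
        \<le> (3 * \<eta> + h) * m l + 2 * (\<eta> * m l)"
    proof (rule N.delayed_hitting_estimate[where J = J and B = B and E = E])
      show "finite J" by fact
      show "j < k l" if "j \<in> J" for j
        using that by (rule J_k)
      show "B j \<in> N.events" for j
        by (rule B)
      show "disjoint_family_on B J"
        by (auto simp: disjoint_family_on_def B_def)
      show "{x \<in> space N. hitting_time T (A l) x = enat (k l)} \<in> N.events"
        using meas_N[OF hit] by measurable
      have Tj: "T ^^ j \<in> measurable N M" for j
        using T_pow by (rule meas_N)
      show shift_events: "{x \<in> space N. hitting_time T (A l) ((T ^^ j) x) = enat (k l - j)} \<in> N.events" for j
        using measurable_compose[OF Tj hit] by measurable
      show "E \<in> N.events"
        by (rule E)
      show "N.prob E \<le> \<eta> * m l"
        using early_l \<nu> by (auto simp: N_def E_def)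
      show "x \<in> E" if "x \<in> B j" "hitting_time T (A l) x \<le> enat j" "(T ^^ k l) x \<in> A l" for j x
        using that by (simp add: E_def B_def)
      show "N.prob (space N - (\<Union>j\<in>J. B j)) \<le> \<eta> * m l"
      proof -
        \<comment> \<open>\<open>N\<close> has underlying space \<open>A l\<close> but is
          concentrated on \<open>Ac l\<close>, so the uncovered part has the mass of the long-delay
          set \<open>?L\<close>, which includes infinite delays.\<close>
        let ?L = "{x \<in> Ac l. ereal (m l) * ereal_of_enat (\<tau> l x) > ereal h}"
        have "x \<in> ?L \<longleftrightarrow> x \<in> Ac l - (\<Union>j\<in>J. B j)" for x
          using m[of l] by (cases "\<tau> l x") (auto simp: B_def J_def not_le)
        then have L: "?L = Ac l \<inter> (space N - (\<Union>j\<in>J. B j))"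
          using Ac(2)[of l] by (auto simp: space)
        have compl: "space N - (\<Union>j\<in>J. B j) \<in> N.events"
          using B \<open>finite J\<close> by auto
        have "Ac l \<in> N.events"
          using Ac by (simp add: events)
        then have "N.prob (space N - (\<Union>j\<in>J. B j)) = N.prob ?L"
          using compl by (simp add: L N_eq)
        then show ?thesis
          using \<tau>_l \<nu> by (auto simp: N_def)
      qed
      show "0 \<le> p (k l)" "p (k l) \<le> 1"
        by (simp_all add: p_def)
      show "0 \<le> (3 * \<eta> + h) * m l"
        using \<eta> h m[of l] by simp
      fix j assume "j \<in> J"
      define C where "C = {x \<in> space N. hitting_time T (A l) ((T ^^ j) x) = enat (k l - j)}"
      have C: "C \<in> N.events"
        unfolding C_def by (rule shift_events)
      show "\<bar>N.prob (B j \<inter> {x \<in> space N. hitting_time T (A l) ((T ^^ j) x) = enat (k l - j)}) - N.prob (B j) * p (k l)\<bar>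
          \<le> (3 * \<eta> + h) * m l * N.prob (B j)"
        unfolding C_def[symmetric]
      proof (cases "0 < N.prob (B j)")
        case True
        let ?\<nu> = "distr (cond_measure N (B j)) M (T ^^ j)"
        define r where "r = \<P>(x in ?\<nu>. hitting_time T (A l) x = enat (k l - j))"
        have "?\<nu> \<in> \<V>"
          using \<V>[OF \<open>\<nu> l \<in> V l\<close>, of j] True by (simp add: N_def B_def)
        have Tj': "T ^^ j \<in> measurable (cond_measure N (B j)) M"
          using Tj by (simp cong: measurable_cong_sets)
        have "r = measure (cond_measure N (B j))
            ((T ^^ j) -` {x \<in> space M. hitting_time T (A l) x = enat (k l - j)} \<inter> space N)"
          unfolding r_def by (subst measure_distr[OF Tj']) auto
        also have "(T ^^ j) -` {x \<in> space M. hitting_time T (A l) x = enat (k l - j)} \<inter> space N = C"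
          using measurable_space[OF Tj] by (auto simp: C_def)
        also have "measure (cond_measure N (B j)) C = N.prob (B j \<inter> C) / N.prob (B j)"
          using True C by (rule N.measure_cond_measure)
        finally have BC: "N.prob (B j \<inter> C) = N.prob (B j) * r"
          using True by simp
        have shift: "m l * real (k l - j) + m l * real j = m l * real (k l)"
          using J_k[OF \<open>j \<in> J\<close>] by (simp add: of_nat_diff algebra_simps)
        have mj: "0 \<le> m l * real j" "m l * real j \<le> h"
          using \<open>j \<in> J\<close> m[of l] by (simp_all add: J_def)
        have in_range: "\<delta> / 2 \<le> m l * real (k l - j)" "m l * real (k l - j) \<le> 1 / (\<delta> / 2)"
          using shift mj h(2) scale(1) half_scale(2)[of l] by linarith+
        define g where "g n = \<theta> * exp (- \<theta> * (m l * real n))" for n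
        have "\<bar>r - p (k l - j)\<bar> \<le> \<eta> * m l"
          using LLT_l[rule_format, of "k l - j" ?\<nu>] in_range \<open>?\<nu> \<in> \<V>\<close> by (simp add: r_def p_def m_def)
        moreover have "\<bar>p (k l - j) - g (k l - j) * m l\<bar> \<le> \<eta> * m l" "\<bar>p (k l) - g (k l) * m l\<bar> \<le> \<eta> * m l"
          using limit_l in_range half_scale by (simp_all add: p_def g_def)
        \<comment> \<open>The density \<open>g\<close> changes by at most
          \<open>\<theta> * \<theta> * (m l * j)\<close> over the delay, hence by at most
          \<open>h\<close>.\<close>
        moreover have "\<bar>g (k l - j) * m l - g (k l) * m l\<bar> \<le> h * m l"
        proof -
          define d where "d = exp (- \<theta> * (m l * real (k l - j))) - exp (- \<theta> * (m l * real (k l)))"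
          have d: "0 \<le> d" "d \<le> \<theta> * (m l * real j)"
            using exp_decrement_bounds(1,3)[of \<theta> "m l * real j" "m l * real (k l - j)"] \<theta> mj m[of l]
            by (auto simp: d_def shift intro: order_trans[rotated])
          have "\<theta> * (m l * real j) \<le> 1 * h"
            using \<theta> mj by (intro mult_mono) auto
          with d have "d \<le> h"
            by linarith
          then have "\<theta> * d \<le> 1 * h"
            using \<theta> d by (intro mult_mono) auto
          then have "\<bar>\<theta> * d\<bar> * m l \<le> h * m l"
            using \<theta> d m[of l] by simp
          moreover have "g (k l - j) * m l - g (k l) * m l = \<theta> * d * m l"
            by (simp add: g_def d_def algebra_simps)
          ultimately show ?thesis
            using m[of l] by (simp add: abs_mult)
        qed
        ultimately have "\<bar>r - p (k l)\<bar> \<le> 3 * (\<eta> * m l) + h * m l"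
          by linarith
        then have "N.prob (B j) * \<bar>r - p (k l)\<bar> \<le> N.prob (B j) * (3 * (\<eta> * m l) + h * m l)"
          by (intro mult_left_mono) auto
        moreover have "\<bar>N.prob (B j \<inter> C) - N.prob (B j) * p (k l)\<bar> = N.prob (B j) * \<bar>r - p (k l)\<bar>"
          by (simp add: BC abs_mult flip: right_diff_distrib)
        ultimately show "\<bar>N.prob (B j \<inter> C) - N.prob (B j) * p (k l)\<bar> \<le> (3 * \<eta> + h) * m l * N.prob (B j)"
          by (simp only: algebra_simps)
      next
        \<comment> \<open>On a piece of mass zero no member of \<open>\<V>\<close> is available, and
          both sides of the estimate vanish.\<close>
        case False
        moreover have "N.prob (B j \<inter> C) \<le> N.prob (B j)"
          using B by (intro N.finite_measure_mono) auto
        ultimately show "\<bar>N.prob (B j \<inter> C) - N.prob (B j) * p (k l)\<bar> \<le> (3 * \<eta> + h) * m l * N.prob (B j)"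
          using measure_nonneg[of N "B j"] measure_nonneg[of N "B j \<inter> C"]
          by (simp add: not_less)
      qed
    qed
    also have "\<dots> \<le> \<epsilon> * m l"
    proof -
      have "(3 * \<eta> + h) * m l + 2 * (\<eta> * m l) = (5 * \<eta> + h) * m l"
        by (simp add: algebra_simps)
      also have "\<dots> \<le> \<epsilon> * m l"
        using h \<eta> m[of l] by (intro mult_right_mono) (auto simp: \<eta>_def)
      finally show ?thesis .
    qed
    finally show "\<bar>\<P>(x in cond_measure (\<nu> l) (Ac l). hitting_time T (A l) x = enat (k l))
        - \<P>(x in M. hitting_time T (A l) x = enat (k l))\<bar> \<le> \<epsilon> * m l"
      by (simp add: N_def p_def)
  qed
  then show "\<exists>l0. \<forall>l\<ge>l0. \<forall>\<nu>\<in>Pi UNIV V.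
      \<bar>\<bar>\<P>(x in cond_measure (\<nu> l) (Ac l). hitting_time T (A l) x = enat (k l))
        - \<P>(x in M. hitting_time T (A l) x = enat (k l))\<bar>\<bar> \<le> \<epsilon> * measure M (A l)"
    by (simp add: eventually_sequentially m_def)
qed

section \<open>Both assertions for an ergodic measure-preserving map\<close>

theorem theorem2p4:
  fixes M :: "'a measure" and T :: "'a \<Rightarrow> 'a" and \<theta> :: real
    and A Ab Ac :: "nat \<Rightarrow> 'a set"
    and V :: "nat \<Rightarrow> 'a measure set"
  assumes "prob_space M"
    and "ergodic_measure_preserving M T"
    and "0 < \<theta>" and "\<theta> \<le> 1"
    and "\<And>l. A l \<in> sets M"
    and "\<And>l. 0 < measure M (A l)"
    and "(\<lambda>l. measure M (A l)) \<longlonglongrightarrow> 0"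
    and "\<And>l. Ab l \<in> sets M" and "\<And>l. Ac l \<in> sets M"
    and "\<And>l. A l = Ab l \<union> Ac l" and "\<And>l. Ab l \<inter> Ac l = {}"
    and "weak_conv
           (\<lambda>l t. \<P>(x in M. ereal (measure M (A l)) * ereal_of_enat (hitting_time T (A l) x) \<le> ereal t))
           (\<lambda>t. if t < 0 then 0 else 1 - exp (- \<theta> * t))"
    and "\<And>l. V l \<subseteq> prob_measures_on (restrict_space M (A l))"
    and "(\<lambda>l. SUP \<nu>\<in>V l. ennreal \<bar>measure \<nu> (Ac l) - \<theta>\<bar>) \<longlonglongrightarrow> 0"
    and "(\<lambda>l. emeasure M (A l) *
           (SUP \<nu>\<in>V l. esssup (cond_measure \<nu> (Ab l))
              (\<lambda>x. indicator (Ab l) x * ennreal_of_enat (hitting_time T (A l) x)))) \<longlonglongrightarrow> 0"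
  shows
    "(LLT_circ M T A Ac V \<longrightarrow>
        (\<forall>\<delta>\<in>{0<..1}.
           uniformly_asymp_equiv (Pi UNIV V \<times> scale_seqs_delta M A \<delta>)
             (\<lambda>(\<nu>, k) l. \<P>(x in \<nu> l. hitting_time T (A l) x = enat (k l)))
             (\<lambda>(\<nu>, k) l. \<theta>\<^sup>2 * exp (- \<theta> * measure M (A l) * real (k l)) * measure M (A l))))
     \<and>
     ((\<exists>(\<tau> :: nat \<Rightarrow> 'a \<Rightarrow> enat) (\<V> :: 'a measure set).
         (\<forall>l. \<tau> l \<in> measurable (restrict_space M (Ac l)) (count_space UNIV)) \<and>
         (\<forall>\<epsilon>>0.
            uniformly_smallo (Pi UNIV V)
              (\<lambda>\<nu> l. measure (cond_measure (\<nu> l) (Ac l))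
                 {x \<in> Ac l. ereal (measure M (A l)) * ereal_of_enat (\<tau> l x) > ereal \<epsilon>})
              (\<lambda>l. measure M (A l))) \<and>
         \<V> \<subseteq> prob_measures_on M \<and>
         LLT_uniform M T A \<V> \<and>
         (\<forall>l. \<forall>\<nu>\<in>V l. \<forall>j::nat.
            measure (cond_measure \<nu> (Ac l)) {x \<in> Ac l. \<tau> l x = enat j} > 0 \<longrightarrow>
            distr (cond_measure (cond_measure \<nu> (Ac l)) {x \<in> Ac l. \<tau> l x = enat j}) M (T ^^ j) \<in> \<V>) \<and>
         (\<forall>k\<in>scale_seqs M A.
            uniformly_smallo (Pi UNIV V)
              (\<lambda>\<nu> l. measure (cond_measure (\<nu> l) (Ac l))
                 {x \<in> Ac l. hitting_time T (A l) x \<le> \<tau> l x \<and> (T ^^ k l) x \<in> A l})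
              (\<lambda>l. measure M (A l))))
      \<longrightarrow> LLT_circ M T A Ac V)"
proof -
  have T: "T \<in> measurable M M" "distr M M T = M"
    using assms(2) by (auto simp: ergodic_measure_preserving_def)
  \<comment> \<open>Both assertions use the exponential limit law only through this local
    form.\<close>
  have local_limit: "\<forall>\<^sub>F l in sequentially. \<forall>k. \<delta> \<le> measure M (A l) * real k \<and> measure M (A l) * real k \<le> 1 / \<delta> \<longrightarrow>
      \<bar>\<P>(x in M. hitting_time T (A l) x = enat k)
        - \<theta> * exp (- \<theta> * (measure M (A l) * real k)) * measure M (A l)\<bar> \<le> \<epsilon> * measure M (A l)"
    if "0 < \<delta>" "0 < \<epsilon>" for \<delta> \<epsilon>
    using assms(1) T assms(3-6,12) that by (rule hitting_time_local_limit)
  have "Ac l \<subseteq> A l" for l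
    using assms(10) by blast
  then show ?thesis
    using asymp_equiv_of_LLT_circ[OF assms(1) T(1) assms(3-6,8-11) local_limit assms(13-15)]
      LLT_circ_of_delay[OF assms(1) T(1) assms(3-6,9) _ local_limit assms(13,14)]
    by blast
qed

end
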